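(* Let $n\ge 7$ and let $\rho:B_n\to GL_r(\mathbb{C})$ be an irreducible representation of corank $2$. Then there is $u\in\mathbb{C}^*$, $u\ne 1$, such that $\rho$ is equivalent to the specialization $\tau_n(u):B_n\to GL_n(\mathbb{C})$ of the standard representation.
   Context: $B_n$ is the Artin braid group on $n$ strings, $B_n=\langle \sigma_1,\dots,\sigma_{n-1}\mid \sigma_i\sigma_{i+1}\sigma_i=\sigma_{i+1}\sigma_i\sigma_{i+1}\ (1\le i\le n-2),\ \sigma_i\sigma_j=\sigma_j\sigma_i\ (|i-j|\ge 2)\rangle$. The corank of a representation $\rho:B_n\to GL_r(\mathbb{C})$ is $\operatorname{rank}(\rho(\sigma_i)-1)$; it does not depend on $i$ because the $\sigma_i$ are conjugate in $B_n$. The standard representation $\tau_n:B_n\to GL_n(\mathbb{Z}[t^{\pm1}])$ is defined by $$\tau_n(\sigma_i)=\begin{pmatrix} I_{i-1}&&&\\ &0&t&\\ &1&0&\\ &&&I_{n-1-i}\end{pmatrix},\quad i=1,\dots,n-1,$$ where $I_k$ is the $k\times k$ identity matrix and the block $\begin{pmatrix}0&t\\1&0\end{pmatrix}$ occupies rows and columns $i,i+1$. For $u\in\mathbb{C}^*$, $\tau_n(u):B_n\to GL_n(\mathbb{C})$ is the specialization $t=u$. Two representations are equivalent if they are conjugate by an invertible complex matrix. *)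

theory Defs
  imports
    "HOL-Algebra.Coset"
    "Jordan_Normal_Form.DL_Rank"
    "Jordan_Normal_Form.Matrix_Kernel"
    "HOL.Complex"
begin

section \<open>Groups given by generators and relations\<close>

text \<open>A word is a list of signed generators; \<open>(s, True)\<close> stands for \<open>s\<close> and
  \<open>(s, False)\<close> for the inverse of \<open>s\<close>.\<close>

type_synonym 'a gword = "('a \<times> bool) list"

inductive pres_eq :: "'a set \<Rightarrow> ('a gword \<times> 'a gword) set \<Rightarrow> 'a gword \<Rightarrow> 'a gword \<Rightarrow> bool"
  for S :: "'a set" and R :: "('a gword \<times> 'a gword) set" where
  refl: "w \<in> lists (S \<times> UNIV) \<Longrightarrow> pres_eq S R w w"
| sym: "pres_eq S R v w \<Longrightarrow> pres_eq S R w v"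
| trans: "pres_eq S R u v \<Longrightarrow> pres_eq S R v w \<Longrightarrow> pres_eq S R u w"
| cancel: "\<lbrakk>s \<in> S; x \<in> lists (S \<times> UNIV); y \<in> lists (S \<times> UNIV)\<rbrakk>
    \<Longrightarrow> pres_eq S R (x @ [(s, b), (s, \<not> b)] @ y) (x @ y)"
| rel: "\<lbrakk>(v, w) \<in> R; v \<in> lists (S \<times> UNIV); w \<in> lists (S \<times> UNIV);
      x \<in> lists (S \<times> UNIV); y \<in> lists (S \<times> UNIV)\<rbrakk>
    \<Longrightarrow> pres_eq S R (x @ v @ y) (x @ w @ y)"

definition pres_class :: "'a set \<Rightarrow> ('a gword \<times> 'a gword) set \<Rightarrow> 'a gword \<Rightarrow> 'a gword set" where
  "pres_class S R w = {v. pres_eq S R w v}"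

text \<open>The group generated by \<open>S\<close> with defining relations \<open>v = w\<close> for \<open>(v, w) \<in> R\<close>.\<close>

definition presented_group ::
    "'a set \<Rightarrow> ('a gword \<times> 'a gword) set \<Rightarrow> 'a gword set monoid" where
  "presented_group S R =
    \<lparr>carrier = pres_class S R ` lists (S \<times> UNIV),
     mult = (\<lambda>X Y. \<Union>v\<in>X. \<Union>w\<in>Y. pres_class S R (v @ w)),
     one = pres_class S R []\<rparr>"

definition word_eval :: "('b, 'c) monoid_scheme \<Rightarrow> ('a \<Rightarrow> 'b) \<Rightarrow> 'a gword \<Rightarrow> 'b" where
  "word_eval G f w =
    foldr (\<lambda>(s, b) y. (if b then f s else inv\<^bsub>G\<^esub> (f s)) \<otimes>\<^bsub>G\<^esub> y) w \<one>\<^bsub>G\<^esub>"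

text \<open>The homomorphism from a presented group to \<open>G\<close> extending an assignment \<open>f\<close> of the
  generators. The choice of representative is immaterial as soon as \<open>f\<close> respects the defining
  relations, see \<open>pres_lift_class\<close> and \<open>pres_lift_hom\<close> below.\<close>

definition pres_lift :: "('b, 'c) monoid_scheme \<Rightarrow> ('a \<Rightarrow> 'b) \<Rightarrow> 'a gword set \<Rightarrow> 'b" where
  "pres_lift G f X = word_eval G f (SOME w. w \<in> X)"


section \<open>The braid group and its representations\<close>

definition braid_rels :: "nat \<Rightarrow> (nat gword \<times> nat gword) set" where
  "braid_rels n =
    {([(i, True), (i + 1, True), (i, True)], [(i + 1, True), (i, True), (i + 1, True)]) | i.
        1 \<le> i \<and> i + 2 \<le> n} \<union>
    {([(i, True), (j, True)], [(j, True), (i, True)]) | i j.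
        i \<in> {1..<n} \<and> j \<in> {1..<n} \<and> \<bar>int i - int j\<bar> \<ge> 2}"

definition braid_group :: "nat \<Rightarrow> nat gword set monoid" where
  "braid_group n = presented_group {1..<n} (braid_rels n)"

definition sigma :: "nat \<Rightarrow> nat \<Rightarrow> nat gword set" where
  "sigma n i = pres_class {1..<n} (braid_rels n) [(i, True)]"

definition GL :: "nat \<Rightarrow> 'a::comm_ring_1 mat monoid" where
  "GL r = units_of (ring_mat TYPE('a) r ())"

text \<open>By \<open>corank_eq\<close> below, the choice of the generator is immaterial.\<close>

definition corank :: "nat \<Rightarrow> nat \<Rightarrow> (nat gword set \<Rightarrow> complex mat) \<Rightarrow> nat" where
  "corank n r \<rho> = vec_space.rank r (\<rho> (sigma n 1) - 1\<^sub>m r)"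

definition irreducible_rep :: "('g, 'x) monoid_scheme \<Rightarrow> nat \<Rightarrow> ('g \<Rightarrow> complex mat) \<Rightarrow> bool" where
  "irreducible_rep G r \<rho> \<longleftrightarrow> r > 0 \<and>
    (\<forall>W. subspace class_ring W (module_vec TYPE(complex) r) \<and>
         (\<forall>g\<in>carrier G. \<forall>w\<in>W. \<rho> g *\<^sub>v w \<in> W)
       \<longrightarrow> W = {0\<^sub>v r} \<or> W = carrier_vec r)"

text \<open>\<open>similar_mat_wit A B P Q\<close> says that \<open>A\<close>, \<open>B\<close>, \<open>P\<close>, \<open>Q\<close> are square of the same size,
  \<open>P\<close> and \<open>Q\<close> are mutually inverse and \<open>A = P * B * Q\<close>. In particular equivalent
  representations have the same dimension.\<close>

definition equivalent_reps ::
    "('g, 'x) monoid_scheme \<Rightarrow> ('g \<Rightarrow> complex mat) \<Rightarrow> ('g \<Rightarrow> complex mat) \<Rightarrow> bool" where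
  "equivalent_reps G \<rho> \<rho>' \<longleftrightarrow>
    (\<exists>P Q. \<forall>g\<in>carrier G. similar_mat_wit (\<rho> g) (\<rho>' g) P Q)"

text \<open>The generators of the braid group are numbered from 1, the rows and columns of a matrix
  from 0.\<close>

definition standard_mat :: "nat \<Rightarrow> 'a::comm_ring_1 \<Rightarrow> nat \<Rightarrow> 'a mat" where
  "standard_mat n t i = mat n n (\<lambda>(a, b).
     if (a + 1, b + 1) = (i, i + 1) then t
     else if (a + 1, b + 1) = (i + 1, i) then 1
     else if a = b \<and> a + 1 \<noteq> i \<and> a + 1 \<noteq> i + 1 then 1
     else 0)"

text \<open>The standard representation over a commutative ring with a distinguished unit \<open>t\<close>. Over
  the Laurent polynomials in \<open>t\<close> with integer coefficients this is the generic representation,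
  and substituting \<open>u\<close> for \<open>t\<close> gives its specialization \<open>standard_rep n u\<close>.\<close>

definition standard_rep :: "nat \<Rightarrow> 'a::comm_ring_1 \<Rightarrow> nat gword set \<Rightarrow> 'a mat" where
  "standard_rep n t = pres_lift (GL n) (standard_mat n t)"


section \<open>The definitions are meaningful\<close>

lemma pres_eq_lists:
  assumes "pres_eq S R v w"
  shows "v \<in> lists (S \<times> UNIV) \<and> w \<in> lists (S \<times> UNIV)"
  using assms by induction auto

lemma pres_eq_ctxt:
  assumes "pres_eq S R v w" "x \<in> lists (S \<times> UNIV)" "y \<in> lists (S \<times> UNIV)"
  shows "pres_eq S R (x @ v @ y) (x @ w @ y)"
  using assms
proof induction
  case (refl w)
  then show ?case by (intro pres_eq.refl) auto
next
  case (sym v w)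
  then show ?case by (blast intro: pres_eq.sym)
next
  case (trans u v w)
  then show ?case by (blast intro: pres_eq.trans)
next
  case (cancel s x' y' b)
  then show ?case using pres_eq.cancel[of s S "x @ x'" "y' @ y" R b] by simp
next
  case (rel v w x' y')
  then show ?case using pres_eq.rel[of v w R S "x @ x'" "y' @ y"] by simp
qed

lemma pres_eq_append:
  assumes "pres_eq S R v v'" "pres_eq S R w w'"
  shows "pres_eq S R (v @ w) (v' @ w')"
proof -
  have "w \<in> lists (S \<times> UNIV)" "v' \<in> lists (S \<times> UNIV)"
    using assms pres_eq_lists by blast+
  then have "pres_eq S R ([] @ v @ w) ([] @ v' @ w)" "pres_eq S R (v' @ w @ []) (v' @ w' @ [])"
    using assms by (intro pres_eq_ctxt; simp)+
  then show ?thesis using pres_eq.trans[of S R "v @ w" "v' @ w" "v' @ w'"] by simp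
qed

lemma pres_class_eq_iff:
  assumes "v \<in> lists (S \<times> UNIV)"
  shows "pres_class S R v = pres_class S R w \<longleftrightarrow> pres_eq S R v w"
proof
  assume eq: "pres_class S R v = pres_class S R w"
  have "v \<in> pres_class S R v" using assms by (simp add: pres_class_def pres_eq.refl)
  then have "pres_eq S R w v" unfolding eq by (simp add: pres_class_def)
  then show "pres_eq S R v w" by (rule pres_eq.sym)
next
  assume vw: "pres_eq S R v w"
  have "pres_eq S R v u \<longleftrightarrow> pres_eq S R w u" for u
    using pres_eq.trans[OF vw, of u] pres_eq.trans[OF pres_eq.sym[OF vw], of u] by blast
  then show "pres_class S R v = pres_class S R w" by (simp add: pres_class_def)
qed

lemma pres_mult_class:
  assumes "v \<in> lists (S \<times> UNIV)" "w \<in> lists (S \<times> UNIV)"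
  shows "pres_class S R v \<otimes>\<^bsub>presented_group S R\<^esub> pres_class S R w = pres_class S R (v @ w)"
proof -
  have eq: "pres_class S R (v' @ w') = pres_class S R (v @ w)"
    if "v' \<in> pres_class S R v" "w' \<in> pres_class S R w" for v' w'
  proof -
    have "pres_eq S R (v @ w) (v' @ w')"
      using that by (intro pres_eq_append) (simp_all add: pres_class_def)
    moreover have "v @ w \<in> lists (S \<times> UNIV)" using assms by simp
    ultimately show ?thesis using pres_class_eq_iff by metis
  qed
  have "v \<in> pres_class S R v" "w \<in> pres_class S R w"
    using assms by (simp_all add: pres_class_def pres_eq.refl)
  then have "(\<Union>v'\<in>pres_class S R v. \<Union>w'\<in>pres_class S R w. pres_class S R (v' @ w')) =
      pres_class S R (v @ w)"
    using eq by blast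
  then show ?thesis by (simp add: presented_group_def)
qed

lemma pres_one: "\<one>\<^bsub>presented_group S R\<^esub> = pres_class S R []"
  by (simp add: presented_group_def)

lemma pres_carrier: "carrier (presented_group S R) = pres_class S R ` lists (S \<times> UNIV)"
  by (simp add: presented_group_def)

lemma pres_left_inverse:
  assumes "w \<in> lists (S \<times> UNIV)"
  shows "\<exists>v \<in> lists (S \<times> UNIV). pres_eq S R (v @ w) []"
  using assms
proof (induction w)
  case Nil
  then show ?case by (auto intro!: bexI[of _ "[]"] pres_eq.refl)
next
  case (Cons a w)
  obtain s b where a: "a = (s, b)" by (cases a)
  from Cons obtain v where v: "v \<in> lists (S \<times> UNIV)" "pres_eq S R (v @ w) []" by auto
  have s: "s \<in> S" using Cons a by auto
  have "pres_eq S R (v @ [(s, \<not> b), (s, \<not> \<not> b)] @ w) (v @ w)"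
    using v Cons s by (intro pres_eq.cancel) auto
  from pres_eq.trans[OF this v(2)] have "pres_eq S R ((v @ [(s, \<not> b)]) @ a # w) []"
    using a by simp
  then show ?case using v s by (intro bexI[of _ "v @ [(s, \<not> b)]"]) auto
qed

lemma group_presented_group: "group (presented_group S R)" (is "group ?G")
proof (rule groupI)
  have closed: "pres_class S R w \<in> carrier ?G" if "w \<in> lists (S \<times> UNIV)" for w
    using that by (simp only: pres_carrier imageI)
  show "\<one>\<^bsub>?G\<^esub> \<in> carrier ?G" by (simp only: pres_one closed lists.Nil)
  fix x assume "x \<in> carrier ?G"
  then obtain u where u: "u \<in> lists (S \<times> UNIV)" "x = pres_class S R u"
    unfolding pres_carrier by blast
  then obtain v where v: "v \<in> lists (S \<times> UNIV)" "pres_eq S R (v @ u) []"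
    using pres_left_inverse by blast
  have "pres_class S R v \<otimes>\<^bsub>?G\<^esub> x = \<one>\<^bsub>?G\<^esub>"
    using u v by (simp add: pres_mult_class pres_one pres_class_eq_iff)
  then show "\<exists>y\<in>carrier ?G. y \<otimes>\<^bsub>?G\<^esub> x = \<one>\<^bsub>?G\<^esub>"
    using closed[OF v(1)] by blast
  show "\<one>\<^bsub>?G\<^esub> \<otimes>\<^bsub>?G\<^esub> x = x"
    using u by (simp add: pres_mult_class pres_one)
  fix y assume "y \<in> carrier ?G"
  then obtain v where v: "v \<in> lists (S \<times> UNIV)" "y = pres_class S R v"
    unfolding pres_carrier by blast
  then show "x \<otimes>\<^bsub>?G\<^esub> y \<in> carrier ?G"
    using u closed[of "u @ v"] by (simp add: pres_mult_class)
  fix z assume "z \<in> carrier ?G"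
  then obtain w where w: "w \<in> lists (S \<times> UNIV)" "z = pres_class S R w"
    unfolding pres_carrier by blast
  then show "x \<otimes>\<^bsub>?G\<^esub> y \<otimes>\<^bsub>?G\<^esub> z = x \<otimes>\<^bsub>?G\<^esub> (y \<otimes>\<^bsub>?G\<^esub> z)"
    using u v by (simp add: pres_mult_class)
qed

lemma word_eval_Nil: "word_eval G f [] = \<one>\<^bsub>G\<^esub>"
  by (simp add: word_eval_def)

lemma word_eval_Cons:
  "word_eval G f ((s, b) # w) = (if b then f s else inv\<^bsub>G\<^esub> (f s)) \<otimes>\<^bsub>G\<^esub> word_eval G f w"
  by (simp add: word_eval_def)

context group
begin

lemma word_eval_closed:
  assumes "f ` S \<subseteq> carrier G" "w \<in> lists (S \<times> UNIV)"
  shows "word_eval G f w \<in> carrier G"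
  using assms(2)
  by (induction w) (use assms(1) in \<open>auto simp: word_eval_Nil word_eval_Cons\<close>)

lemma word_eval_append:
  assumes "f ` S \<subseteq> carrier G" "v \<in> lists (S \<times> UNIV)" "w \<in> lists (S \<times> UNIV)"
  shows "word_eval G f (v @ w) = word_eval G f v \<otimes> word_eval G f w"
  using assms(2)
proof (induction v)
  case Nil
  then show ?case using word_eval_closed[OF assms(1,3)] by (simp add: word_eval_Nil)
next
  case (Cons a v)
  obtain s b where a: "a = (s, b)" by (cases a)
  have "v \<in> lists (S \<times> UNIV)" "f s \<in> carrier G" using Cons a assms(1) by auto
  then show ?case
    using Cons a word_eval_closed[OF assms(1,3)] word_eval_closed[OF assms(1), of v]
    by (auto simp: word_eval_Cons m_assoc)
qed

lemma word_eval_cong: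
  assumes f: "f ` S \<subseteq> carrier G"
    and R: "\<And>v w. (v, w) \<in> R \<Longrightarrow> word_eval G f v = word_eval G f w"
    and eq: "pres_eq S R v w"
  shows "word_eval G f v = word_eval G f w"
  using eq
proof induction
  case (cancel s x y b)
  have "f s \<in> carrier G" using cancel f by auto
  moreover have "word_eval G f y \<in> carrier G" using word_eval_closed[OF f] cancel by blast
  ultimately have "word_eval G f ([(s, b), (s, \<not> b)] @ y) = word_eval G f y"
    by (simp add: word_eval_Cons m_assoc[symmetric])
  moreover have "[(s, b), (s, \<not> b)] @ y \<in> lists (S \<times> UNIV)" using cancel by auto
  ultimately show ?case using word_eval_append[OF f] cancel by metis
next
  case (rel v w x y)
  then show ?case
    using word_eval_append[OF f] R
    by (metis append_in_lists_conv)
qed auto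

lemma pres_lift_class:
  assumes "f ` S \<subseteq> carrier G"
    and "\<And>v w. (v, w) \<in> R \<Longrightarrow> word_eval G f v = word_eval G f w"
    and "w \<in> lists (S \<times> UNIV)"
  shows "pres_lift G f (pres_class S R w) = word_eval G f w"
proof -
  have "w \<in> pres_class S R w" using assms(3) by (simp add: pres_class_def pres_eq.refl)
  then have "(SOME v. v \<in> pres_class S R w) \<in> pres_class S R w" by (rule someI)
  then show ?thesis
    unfolding pres_lift_def
    using word_eval_cong[where S = S and R = R, OF assms(1,2)] by (simp add: pres_class_def)
qed

lemma pres_lift_hom:
  assumes "f ` S \<subseteq> carrier G"
    and "\<And>v w. (v, w) \<in> R \<Longrightarrow> word_eval G f v = word_eval G f w"
  shows "pres_lift G f \<in> hom (presented_group S R) G"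
proof (rule homI)
  fix x assume "x \<in> carrier (presented_group S R)"
  then obtain w where "w \<in> lists (S \<times> UNIV)" "x = pres_class S R w"
    unfolding pres_carrier by blast
  then show "pres_lift G f x \<in> carrier G"
    using pres_lift_class[where S = S and R = R, OF assms] word_eval_closed[OF assms(1)]
    by metis
next
  fix x y
  assume "x \<in> carrier (presented_group S R)" "y \<in> carrier (presented_group S R)"
  then obtain v w where "v \<in> lists (S \<times> UNIV)" "x = pres_class S R v"
    "w \<in> lists (S \<times> UNIV)" "y = pres_class S R w"
    unfolding pres_carrier by blast
  then show "pres_lift G f (x \<otimes>\<^bsub>presented_group S R\<^esub> y) = pres_lift G f x \<otimes> pres_lift G f y"
    using pres_lift_class[where S = S and R = R, OF assms] word_eval_append[OF assms(1)]
    by (simp add: pres_mult_class)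
qed

end

lemma GL_simps:
  "carrier (GL r :: 'a::comm_ring_1 mat monoid) =
    {A \<in> carrier_mat r r. \<exists>B\<in>carrier_mat r r. A * B = 1\<^sub>m r \<and> B * A = 1\<^sub>m r}"
  "mult (GL r) = (*)" "one (GL r) = 1\<^sub>m r"
  by (auto simp: GL_def units_of_def Units_def ring_mat_def)

lemma group_GL: "group (GL r :: 'a::comm_ring_1 mat monoid)"
proof -
  interpret ring "ring_mat TYPE('a) r ()" by (rule ring_mat)
  show ?thesis unfolding GL_def by (rule units_group)
qed

lemma standard_mat_carrier: "standard_mat n t i \<in> carrier_mat n n"
  by (simp add: standard_mat_def)

lemma standard_mat_mult:
  assumes "B \<in> carrier_mat n n" "1 \<le> i" "i < n"
  shows "standard_mat n t i * B = mat n n (\<lambda>(a, b).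
    if a + 1 = i then t * B $$ (i, b) else if a = i then B $$ (i - 1, b) else B $$ (a, b))"
    (is "_ = ?M")
proof (rule eq_matI)
  fix a b assume "a < dim_row ?M" "b < dim_col ?M"
  then have ab: "a < n" "b < n" by auto
  define k where "k = (if a + 1 = i then i else if a = i then i - 1 else a)"
  have k: "k < n" using ab assms by (auto simp: k_def)
  have "(standard_mat n t i * B) $$ (a, b) = (\<Sum>j<n. standard_mat n t i $$ (a, j) * B $$ (j, b))"
    using ab assms(1) standard_mat_carrier[of n t i]
    by (auto simp: scalar_prod_def times_mat_def row_def col_def lessThan_atLeast0)
  also have "\<dots> = (\<Sum>j<n. if j = k then standard_mat n t i $$ (a, k) * B $$ (k, b) else 0)"
    using ab assms(2,3) by (intro sum.cong) (auto simp: standard_mat_def k_def)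
  also have "\<dots> = standard_mat n t i $$ (a, k) * B $$ (k, b)"
    using k by simp
  also have "\<dots> = ?M $$ (a, b)"
    using ab k assms(2,3) by (auto simp: standard_mat_def k_def)
  finally show "(standard_mat n t i * B) $$ (a, b) = ?M $$ (a, b)" .
qed (use assms in \<open>auto simp: standard_mat_def\<close>)

lemma standard_mat_inv:
  assumes "t * s = 1" "1 \<le> i" "i < n"
  shows "standard_mat n t i * transpose_mat (standard_mat n s i) = 1\<^sub>m n"
proof (rule eq_matI)
  let ?B = "transpose_mat (standard_mat n s i)"
  have B: "?B \<in> carrier_mat n n" using standard_mat_carrier[of n s i] by simp
  fix a b assume "a < dim_row (1\<^sub>m n)" "b < dim_col (1\<^sub>m n)"
  then have ab: "a < n" "b < n" by auto
  then have "(standard_mat n t i * ?B) $$ (a, b) =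
    (if a + 1 = i then t * ?B $$ (i, b) else if a = i then ?B $$ (i - 1, b) else ?B $$ (a, b))"
    unfolding standard_mat_mult[OF B assms(2,3)] by simp
  also have "\<dots> = (if a = b then 1 else 0)"
    using ab assms by (auto simp: standard_mat_def)
  finally show "(standard_mat n t i * ?B) $$ (a, b) = 1\<^sub>m n $$ (a, b)" using ab by simp
qed (use standard_mat_carrier in \<open>auto simp: standard_mat_def\<close>)

lemma standard_mat_GL:
  fixes t :: "'a::field"
  assumes "t \<noteq> 0" "1 \<le> i" "i < n"
  shows "standard_mat n t i \<in> carrier (GL n)"
proof -
  let ?B = "transpose_mat (standard_mat n (inverse t) i)"
  have "standard_mat n t i * ?B = 1\<^sub>m n"
    using assms by (intro standard_mat_inv) auto
  moreover have "?B \<in> carrier_mat n n"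
    using standard_mat_carrier[of n "inverse t" i] by simp
  ultimately show ?thesis
    using mat_mult_left_right_inverse[of "standard_mat n t i" n ?B] standard_mat_carrier[of n t i]
    by (auto simp: GL_simps)
qed

lemma standard_mat_braid:
  assumes "1 \<le> i" "i + 2 \<le> n"
  shows "standard_mat n t i * (standard_mat n t (i + 1) * standard_mat n t i) =
    standard_mat n t (i + 1) * (standard_mat n t i * standard_mat n t (i + 1))"
proof -
  have 1: "standard_mat n t i * B = mat n n (\<lambda>(a, b).
      if a + 1 = i then t * B $$ (i, b) else if a = i then B $$ (i - 1, b) else B $$ (a, b))"
    if "B \<in> carrier_mat n n" for B using standard_mat_mult[OF that] assms by simp
  have 2: "standard_mat n t (i + 1) * B = mat n n (\<lambda>(a, b).
      if a + 1 = i + 1 then t * B $$ (i + 1, b) else if a = i + 1 then B $$ (i, b) else B $$ (a, b))"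
    if "B \<in> carrier_mat n n" for B
    using assms by (subst standard_mat_mult[OF that]) (auto intro!: eq_matI)
  obtain k where k: "i = Suc k" using assms(1) by (cases i) auto
  show ?thesis
    using assms(2) unfolding k
    apply (simp only: 1[unfolded k] 2[unfolded k] standard_mat_carrier mat_carrier)
    apply (intro eq_matI)
      apply (auto simp: standard_mat_def)
    done
qed

lemma standard_mat_commute:
  assumes "i \<in> {1..<n}" "j \<in> {1..<n}" "\<bar>int i - int j\<bar> \<ge> 2"
  shows "standard_mat n t i * standard_mat n t j = standard_mat n t j * standard_mat n t i"
proof -
  obtain k l where kl: "i = Suc k" "j = Suc l" using assms(1,2) by (cases i; cases j) auto
  have "k \<noteq> l" "k \<noteq> Suc l" "l \<noteq> Suc k" using assms(3) kl by auto
  then show ?thesis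
    using assms(1,2) standard_mat_mult[OF standard_mat_carrier, of i n t t j]
      standard_mat_mult[OF standard_mat_carrier, of j n t t i]
    unfolding kl
    by (intro eq_matI) (auto simp: standard_mat_def)
qed

lemma standard_rep_respects:
  fixes t :: "'a::comm_ring_1"
  assumes "(v, w) \<in> braid_rels n"
  shows "word_eval (GL n) (standard_mat n t) v = word_eval (GL n) (standard_mat n t) w"
proof -
  note eval = word_eval_Cons word_eval_Nil GL_simps
    right_mult_one_mat[OF standard_mat_carrier]
  from assms consider
    i where "v = [(i, True), (i + 1, True), (i, True)]"
      "w = [(i + 1, True), (i, True), (i + 1, True)]" "1 \<le> i" "i + 2 \<le> n"
  | i j where "v = [(i, True), (j, True)]" "w = [(j, True), (i, True)]"
      "i \<in> {1..<n}" "j \<in> {1..<n}" "\<bar>int i - int j\<bar> \<ge> 2"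
    unfolding braid_rels_def by blast
  then show ?thesis
  proof cases
    case 1
    from standard_mat_braid[OF 1(3,4), of t] show ?thesis
      unfolding 1(1,2) by (simp only: eval if_True)
  next
    case 2
    from standard_mat_commute[OF 2(3,4,5), of t] show ?thesis
      unfolding 2(1,2) by (simp only: eval if_True)
  qed
qed

lemma standard_rep_hom:
  fixes t :: "'a::field"
  assumes "t \<noteq> 0"
  shows "standard_rep n t \<in> hom (braid_group n) (GL n)"
  unfolding standard_rep_def braid_group_def
  using assms standard_mat_GL[of t _ n] standard_rep_respects
  by (intro group.pres_lift_hom[OF group_GL]) auto

lemma standard_rep_sigma:
  fixes t :: "'a::field"
  assumes "t \<noteq> 0" "i \<in> {1..<n}"
  shows "standard_rep n t (sigma n i) = standard_mat n t i"
proof -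
  have "standard_rep n t (sigma n i) = word_eval (GL n) (standard_mat n t) [(i, True)]"
    unfolding standard_rep_def sigma_def
    using assms standard_mat_GL[of t _ n] standard_rep_respects
    by (intro group.pres_lift_class[OF group_GL]) auto
  then show ?thesis
    using standard_mat_carrier[of n t i] by (simp add: word_eval_Cons word_eval_Nil GL_simps)
qed

lemma rank_plus_kernel_dim:
  fixes A :: "'a::field mat"
  assumes A: "A \<in> carrier_mat r r"
  shows "vec_space.rank r A + kernel.dim r A = r"
proof -
  interpret vec_space "TYPE('a)" r .
  have add: "A *\<^sub>v (v + w) = A *\<^sub>v v + A *\<^sub>v w"
    if "v \<in> carrier_vec r" "w \<in> carrier_vec r" for v w
    using that A by (intro mult_add_distrib_mat_vec)
  have smult: "A *\<^sub>v (c \<cdot>\<^sub>v v) = c \<cdot>\<^sub>v (A *\<^sub>v v)" if "v \<in> carrier_vec r" for v c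
    using that A by (intro mult_mat_vec)
  let ?T = "\<lambda>v. A *\<^sub>v v"
  have hom: "?T \<in> LinearCombinations.module_hom class_ring V V"
    unfolding LinearCombinations.module_hom_def using A add smult
    by (simp add: module_vec_simps class_ring_simps)
  have vs: "vectorspace class_ring V" by (rule vec_vs)
  have md: "Module.module class_ring V" by (rule vec_module)
  have mod: "mod_hom class_ring V V ?T"
    by (intro mod_hom.intro mod_hom_axioms.intro md hom)
  have lin: "linear_map class_ring V V ?T"
    by (intro linear_map.intro vs mod)
  have cols: "set (cols A) \<subseteq> carrier_vec r" using A cols_dim by blast
  have "span (set (cols A)) = span_list (cols A)"
    using span_list_as_span[OF cols] by simp
  also have "\<dots> = (\<lambda>v. A *\<^sub>v v) ` carrier_vec r"
  proof -
    have comb: "lincomb_list c (cols A) = A *\<^sub>v vec r c" for c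
      using A cols lincomb_list_as_mat_mult[of "cols A" c] mat_of_cols_cols[of A]
      by (simp add: subset_iff)
    have "v \<in> range (vec r)" if "v \<in> carrier_vec r" for v :: "'a vec"
      using that by (intro image_eqI[of _ _ "\<lambda>i. v $ i"]) auto
    then have "carrier_vec r = range (vec r :: _ \<Rightarrow> 'a vec)" by auto
    then show ?thesis unfolding span_list_def comb by auto
  qed
  finally have im: "mod_hom.im V ?T = span (set (cols A))"
    by (simp add: mod_hom.im_def[OF mod] module_vec_simps)
  have ker: "mod_hom.ker V V ?T = mat_kernel A"
    using A by (auto simp: mod_hom.ker_def[OF mod] mat_kernel module_vec_simps)
  show ?thesis
    using linear_map.rank_nullity[OF lin fin_dim] unfolding im ker rank_def dim_is_n .
qed

lemma rank_conj:
  fixes A :: "'a::field mat"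
  assumes c: "A \<in> carrier_mat r r" "P \<in> carrier_mat r r" "Q \<in> carrier_mat r r"
    and inv: "P * Q = 1\<^sub>m r" "Q * P = 1\<^sub>m r"
  shows "vec_space.rank r (P * A * Q) = vec_space.rank r A"
proof -
  have "kernel.dim r (P * A * Q) = kernel.dim r (P * A)"
    using c inv by (intro mat_kernel_dim_mult_eq_right[of _ r _ _ P]) auto
  also have "\<dots> = kernel.dim r A"
    using mat_kernel_mult_eq[OF c(1,2,3) inv(2)] by simp
  finally show ?thesis
    using rank_plus_kernel_dim[of A r] rank_plus_kernel_dim[of "P * A * Q" r] c by simp
qed

lemma sigma_carrier: "i \<in> {1..<n} \<Longrightarrow> sigma n i \<in> carrier (braid_group n)"
  by (auto simp: sigma_def braid_group_def pres_carrier)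

lemma sigma_braid:
  assumes "1 \<le> i" "i + 2 \<le> n"
  shows "sigma n i \<otimes>\<^bsub>braid_group n\<^esub> (sigma n (i + 1) \<otimes>\<^bsub>braid_group n\<^esub> sigma n i) =
    sigma n (i + 1) \<otimes>\<^bsub>braid_group n\<^esub> (sigma n i \<otimes>\<^bsub>braid_group n\<^esub> sigma n (i + 1))"
proof -
  let ?v = "[(i, True), (i + 1, True), (i, True)]"
  let ?w = "[(i + 1, True), (i, True), (i + 1, True)]"
  have l: "?v \<in> lists ({1..<n} \<times> UNIV)" "?w \<in> lists ({1..<n} \<times> UNIV)" using assms by auto
  have "(?v, ?w) \<in> braid_rels n" unfolding braid_rels_def using assms by blast
  then have "pres_eq {1..<n} (braid_rels n) ([] @ ?v @ []) ([] @ ?w @ [])"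
    by (rule pres_eq.rel) (use l in auto)
  then have "pres_class {1..<n} (braid_rels n) ?v = pres_class {1..<n} (braid_rels n) ?w"
    unfolding append_Nil append_Nil2 pres_class_eq_iff[OF l(1)] .
  then show ?thesis
    using l by (simp add: sigma_def braid_group_def pres_mult_class)
qed

lemma corank_eq:
  assumes \<rho>: "\<rho> \<in> hom (braid_group n) (GL r)" and i: "i \<in> {1..<n}"
  shows "vec_space.rank r (\<rho> (sigma n i) - 1\<^sub>m r) = corank n r \<rho>"
proof -
  have conj: "vec_space.rank r (\<rho> (sigma n (i + 1)) - 1\<^sub>m r) =
      vec_space.rank r (\<rho> (sigma n i) - 1\<^sub>m r)" if i: "1 \<le> i" "i + 2 \<le> n" for i
  proof -
    let ?A = "\<rho> (sigma n i)" and ?B = "\<rho> (sigma n (i + 1))"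
    have s: "sigma n i \<in> carrier (braid_group n)" "sigma n (i + 1) \<in> carrier (braid_group n)"
      using i by (auto intro: sigma_carrier)
    have G: "group (braid_group n)"
      unfolding braid_group_def by (rule group_presented_group)
    have h: "\<rho> (x \<otimes>\<^bsub>braid_group n\<^esub> y) = \<rho> x * \<rho> y"
      if "x \<in> carrier (braid_group n)" "y \<in> carrier (braid_group n)" for x y
      using hom_mult[OF \<rho> that] by (simp only: GL_simps)
    have cl: "x \<otimes>\<^bsub>braid_group n\<^esub> y \<in> carrier (braid_group n)"
      if "x \<in> carrier (braid_group n)" "y \<in> carrier (braid_group n)" for x y
      using that G by (simp add: group.is_monoid monoid.m_closed)
    have braid: "?A * (?B * ?A) = ?B * (?A * ?B)"
      using arg_cong[OF sigma_braid[OF i], of \<rho>] s by (simp only: h cl)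
    have gl: "?A \<in> carrier (GL r)" "?A * ?B \<in> carrier (GL r)" "?B \<in> carrier (GL r)"
      using hom_in_carrier[OF \<rho>] s cl[OF s] h[OF s] by metis+
    then obtain Q where Q: "Q \<in> carrier_mat r r" "(?A * ?B) * Q = 1\<^sub>m r" "Q * (?A * ?B) = 1\<^sub>m r"
      unfolding GL_simps by blast
    have c: "?A \<in> carrier_mat r r" "?B \<in> carrier_mat r r" "?A * ?B \<in> carrier_mat r r"
      using gl unfolding GL_simps by blast+
    have "(?A * ?B) * ?A = ?B * (?A * ?B)"
      using braid c assoc_mult_mat[of ?A r r ?B r ?A r] by simp
    then have "(?A * ?B) * (?A - 1\<^sub>m r) = (?B - 1\<^sub>m r) * (?A * ?B)"
      using c(3) mult_minus_distrib_mat[OF c(3) c(1) one_carrier_mat]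
        minus_mult_distrib_mat[OF c(2) one_carrier_mat c(3)]
        left_mult_one_mat[OF c(3)] right_mult_one_mat[OF c(3)]
      by simp
    then have "(?A * ?B) * (?A - 1\<^sub>m r) * Q = (?B - 1\<^sub>m r) * ((?A * ?B) * Q)"
      using assoc_mult_mat[OF _ c(3) Q(1), of "?B - 1\<^sub>m r" r] by (simp add: minus_carrier_mat)
    also have "\<dots> = ?B - 1\<^sub>m r"
      unfolding Q(2) using right_mult_one_mat[of "?B - 1\<^sub>m r" r r]
      by (simp add: minus_carrier_mat)
    finally show ?thesis
      using rank_conj[OF _ c(3) Q(1) Q(2,3), of "?A - 1\<^sub>m r"] by (simp add: minus_carrier_mat)
  qed
  have "i \<ge> 1" using i by simp
  then have "i < n \<longrightarrow> vec_space.rank r (\<rho> (sigma n i) - 1\<^sub>m r) = corank n r \<rho>"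
  proof (induction i rule: dec_induct)
    case base
    then show ?case by (simp add: corank_def)
  next
    case (step k)
    then show ?case using conj[of k] by simp
  qed
  then show ?thesis using i by simp
qed

end

theory Submission
  imports Defs "HOL-Library.Function_Algebras"
begin

text \<open>Write \<open>S\<^sub>i\<close> for the image of \<open>\<sigma>\<^sub>i\<close>, \<open>A\<^sub>i = S\<^sub>i - 1\<close> and \<open>V\<^sub>i\<close> for the image of \<open>A\<^sub>i\<close>, which is a
  plane because the corank is 2. The argument is elementary linear algebra with these planes.

  \<^bold>\<open>Distant generators.\<close> If \<open>\<bar>i - j\<bar> \<ge> 2\<close>, then \<open>A\<^sub>i\<close> and \<open>A\<^sub>j\<close> commute, so \<open>A\<^sub>j\<close> preserves \<open>V\<^sub>i\<close>. On
  \<open>V\<^sub>1\<close> one thus has a two-dimensional representation of the braid group generated by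
  \<open>\<sigma>\<^sub>3, \<dots>, \<sigma>\<^bsub>n-1\<^esub>\<close>, which has at least five strings because \<open>n \<ge> 7\<close>. A non-scalar operator on a
  plane has a commutative commutant, which forces all these generators to agree on \<open>V\<^sub>1\<close>
  (\<open>agree_on_plane\<close>). Hence \<open>A\<^sub>1A\<^sub>j\<close> is one and the same operator \<open>D\<close> for all \<open>j \<ge> 3\<close>, and likewise
  from the other end of the chain; \<open>D\<close> commutes with every generator, so its image is
  invariant. It cannot be the whole space, since an irreducible representation of this kind
  does not live on a plane (\<open>no_invariant_plane\<close>), so \<open>D = 0\<close>, and by conjugation \<open>A\<^sub>iA\<^sub>j = 0\<close>
  whenever \<open>\<bar>i - j\<bar> \<ge> 2\<close> (\<open>A_far_zero\<close>).

  \<^bold>\<open>Neighbours.\<close> The braid relation says that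
  \<open>E\<^sub>i = A\<^sub>i + A\<^sub>i\<^sup>2 + A\<^sub>iA\<^bsub>i+1\<^esub>A\<^sub>i\<close> is symmetric in \<open>i\<close> and \<open>i + 1\<close>, so its image lies in
  \<open>V\<^sub>i \<inter> V\<^bsub>i+1\<^esub>\<close>. If \<open>E\<^sub>1\<close> vanished, all \<open>E\<^sub>i\<close> would, and the translates of an eigenvector of \<open>A\<^sub>1\<close> in
  \<open>V\<^sub>1\<close> would span an invariant subspace on which \<open>A\<^sub>1\<close> has rank at most 1, as for the reduced
  Burau representation (\<open>E_1_nonzero\<close>). So \<open>V\<^sub>1 \<inter> V\<^sub>2\<close> is not zero, and it is a line, for
  otherwise \<open>V\<^sub>1 = V\<^sub>2\<close> would be an invariant plane.

  \<^bold>\<open>The basis.\<close> Pulling this line back by \<open>S\<^sub>1\<close> gives a vector \<open>e\<close> that is fixed by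
  \<open>S\<^sub>2, \<dots>, S\<^bsub>n-1\<^esub>\<close> and is an eigenvector of \<open>S\<^sub>1\<^sup>2\<close>, with eigenvalue \<open>t\<close> say
  (\<open>stabilised_eigenvector\<close>). By the braid relations, each \<open>S\<^sub>i\<close> acts on the sequence \<open>e\<close>, \<open>S\<^sub>1e\<close>,
  \<open>S\<^sub>2S\<^sub>1e\<close>, \<open>\<dots>\<close> as in the standard representation with parameter \<open>t\<close>; these vectors span by
  irreducibility, and they are independent with \<open>t \<noteq> 1\<close> because each \<open>A\<^sub>i\<close> has rank 2
  (\<open>standard_basis\<close>).

  All this takes place in a vector space that is a type. As the dimension \<open>r\<close> is a variable, column
  vectors of length \<open>r\<close> are embedded in the space of all functions from the natural numbers to
  the complex numbers, and invertible matrices are made to act there, trivially on the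
  coordinates from \<open>r\<close> on.\<close>

section \<open>Operators on planes\<close>

locale complex_space = vector_space scale
  for scale :: "complex \<Rightarrow> 'v::ab_group_add \<Rightarrow> 'v" (infixr "*s" 75)
begin

text \<open>Linearity as a bare conjunction: the operators below are compositions of many factors, and
  this form needs no interpretation of a locale for each of them.\<close>

definition lin :: "('v \<Rightarrow> 'v) \<Rightarrow> bool" where
  "lin f \<longleftrightarrow> (\<forall>u v. f (u + v) = f u + f v) \<and> (\<forall>c u. f (c *s u) = c *s f u)"

lemma lin_add: "lin f \<Longrightarrow> f (u + v) = f u + f v"
  and lin_scale: "lin f \<Longrightarrow> f (c *s u) = c *s f u"
  by (simp_all add: lin_def)

lemma lin_zero: "lin f \<Longrightarrow> f 0 = 0"
  using lin_scale[of f 0 0] by simp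

lemma lin_minus: "lin f \<Longrightarrow> f (- u) = - f u"
  using lin_scale[of f "-1" u] by simp

lemma lin_diff: "lin f \<Longrightarrow> f (u - v) = f u - f v"
  using lin_add[of f u "- v"] by (simp add: lin_minus)

lemma lin_sum: "lin f \<Longrightarrow> f (\<Sum>i\<in>I. g i) = (\<Sum>i\<in>I. f (g i))"
  by (induction I rule: infinite_finite_induct) (auto simp: lin_zero lin_add)

lemma lin_comp: "lin f \<Longrightarrow> lin g \<Longrightarrow> lin (\<lambda>v. f (g v))"
  by (simp add: lin_def)

lemma lin_image_span: "lin f \<Longrightarrow> f ` span B \<subseteq> span (f ` B)"
proof
  fix y assume f: "lin f" and "y \<in> f ` span B"
  then obtain x where x: "x \<in> span B" "y = f x" by blast
  from x(1) have "f x \<in> span (f ` B)"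
  proof (induction rule: span_induct_alt)
    case base
    then show ?case by (simp add: lin_zero[OF f] span_zero)
  next
    case (step c x y)
    then show ?case by (simp add: lin_add[OF f] lin_scale[OF f] span_add span_scale span_base)
  qed
  then show "y \<in> span (f ` B)" using x by simp
qed

lemma subspace_lin_image:
  assumes "lin f" "subspace U"
  shows "subspace (f ` U)"
proof (rule subspaceI)
  show "0 \<in> f ` U" using lin_zero[OF assms(1)] subspace_0[OF assms(2)] by force
next
  fix x y assume "x \<in> f ` U" "y \<in> f ` U"
  then obtain u v where "u \<in> U" "v \<in> U" "x = f u" "y = f v" by blast
  then show "x + y \<in> f ` U"
    using subspace_add[OF assms(2)] by (intro image_eqI[of _ f "u + v"]) (auto simp: lin_add[OF assms(1)])
next
  fix c x assume "x \<in> f ` U"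
  then obtain u where "u \<in> U" "x = f u" by blast
  then show "c *s x \<in> f ` U"
    using subspace_scale[OF assms(2)] by (intro image_eqI[of _ f "c *s u"]) (auto simp: lin_scale[OF assms(1)])
qed

definition indep2 :: "'v \<Rightarrow> 'v \<Rightarrow> bool" where
  "indep2 x y \<longleftrightarrow> (\<forall>p q. p *s x + q *s y = 0 \<longrightarrow> p = 0 \<and> q = 0)"

definition plane :: "'v set \<Rightarrow> bool" where
  "plane P \<longleftrightarrow> (\<exists>x y. indep2 x y \<and> P = span {x, y})"

lemma span_pair: "v \<in> span {x, y} \<longleftrightarrow> (\<exists>p q. v = p *s x + q *s y)"
proof -
  have "v - p *s x - q *s y = 0 \<longleftrightarrow> v = p *s x + q *s y" for p q
    by (simp only: diff_diff_eq right_minus_eq)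
  then show ?thesis unfolding span_breakdown_eq span_empty by simp
qed

lemma indep2_iff_independent: "indep2 x y \<longleftrightarrow> x \<noteq> y \<and> independent {x, y}"
proof
  assume *: "indep2 x y"
  have "x \<noteq> y"
  proof
    assume "x = y"
    then have "1 *s x + (-1) *s y = 0" by simp
    with * have "(1 :: complex) = 0" unfolding indep2_def by blast
    then show False by simp
  qed
  moreover have "y \<noteq> 0"
  proof
    assume "y = 0"
    then have "0 *s x + 1 *s y = 0" by simp
    with * have "(1 :: complex) = 0" unfolding indep2_def by blast
    then show False by simp
  qed
  moreover have "x \<notin> span {y}"
  proof
    assume "x \<in> span {y}"
    then obtain k where "x = k *s y" by (auto simp: span_singleton)
    then have "1 *s x + (-k) *s y = 0" by simp
    with * have "(1 :: complex) = 0" unfolding indep2_def by blast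
    then show False by simp
  qed
  ultimately show "x \<noteq> y \<and> independent {x, y}" by (simp add: independent_insert)
next
  assume *: "x \<noteq> y \<and> independent {x, y}"
  show "indep2 x y"
    unfolding indep2_def
  proof (intro allI impI)
    fix p q assume eq: "p *s x + q *s y = 0"
    have "(\<Sum>v\<in>{x, y}. (if v = x then p else q) *s v) = 0"
      using * eq by auto
    from independentD[OF conjunct2[OF *] _ _ this, of x] independentD[OF conjunct2[OF *] _ _ this, of y]
    show "p = 0 \<and> q = 0" using * by auto
  qed
qed

lemma independent_spans_if_card:
  assumes "independent B" "finite C" "B \<subseteq> span C" "card B = card C"
  shows "span B = span C"
proof -
  have fin: "finite B" using independent_span_bound[OF assms(2,1,3)] by simp
  have "C \<subseteq> span B"
  proof (rule subsetI, rule ccontr)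
    fix c assume c: "c \<in> C" "c \<notin> span B"
    then have "independent (insert c B)" using assms(1) by (simp add: independent_insertI)
    moreover have "insert c B \<subseteq> span C" using c assms(3) by (simp add: span_base)
    ultimately have "card (insert c B) \<le> card C" using independent_span_bound[OF assms(2)] by blast
    moreover have "c \<notin> B" using c(2) span_base by blast
    ultimately show False using assms(4) fin by simp
  qed
  with assms(3) show ?thesis by (simp add: span_eq)
qed

lemma plane_spanned:
  assumes "plane P" "u \<in> P" "v \<in> P" "indep2 u v"
  shows "P = span {u, v}"
proof -
  obtain x y where xy: "indep2 x y" "P = span {x, y}" using assms by (auto simp: plane_def)
  then have "span {u, v} = span {x, y}"
    using assms by (intro independent_spans_if_card) (auto simp: indep2_iff_independent)
  then show ?thesis using xy by simp
qed

lemma not_indep2_line: "\<lbrakk>x \<in> span {v}; y \<in> span {v}\<rbrakk> \<Longrightarrow> \<not> indep2 x y"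
  using independent_span_bound[of "{v}" "{x, y}"]
  by (auto simp: indep2_iff_independent card_insert_if split: if_splits)

lemma dependent_pair_scale:
  assumes "\<not> indep2 x y" "x \<noteq> 0"
  obtains c where "y = c *s x"
proof -
  obtain p q where pq: "p *s x + q *s y = 0" "p \<noteq> 0 \<or> q \<noteq> 0"
    using assms(1) by (auto simp: indep2_def)
  then have q: "q \<noteq> 0" using assms(2) by auto
  have "q *s y = (- p) *s x" using pq by (simp add: eq_neg_iff_add_eq_0 add.commute)
  then have "inverse q *s (q *s y) = inverse q *s (- p) *s x" by simp
  then show ?thesis using q that[of "- (p / q)"] by (simp add: field_simps)
qed

text \<open>A dependent pair spans at most a line. This is how the rank 2 hypothesis is used: two vectors
  whose span contains the image of a generator have to be independent.\<close>

lemma plane_generators_indep2: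
  assumes "plane P" "P \<subseteq> span {a, b}"
  shows "indep2 a b"
proof (rule ccontr)
  assume n: "\<not> indep2 a b"
  obtain x y where xy: "indep2 x y" "P = span {x, y}" using assms by (auto simp: plane_def)
  have "\<exists>v. span {a, b} \<subseteq> span {v}"
  proof (cases "a = 0")
    case True
    then show ?thesis by auto
  next
    case False
    from dependent_pair_scale[OF n False] obtain c where "b = c *s a" .
    then have "span {a, b} \<subseteq> span {a}" by (intro span_minimal) (auto simp: span_base span_scale)
    then show ?thesis by blast
  qed
  then obtain v where "x \<in> span {v}" "y \<in> span {v}"
    using assms(2) xy(2) span_base[of x "{x, y}"] span_base[of y "{x, y}"] by blast
  then show False using not_indep2_line xy(1) by blast
qed

lemma plane_subspace: "plane P \<Longrightarrow> subspace P"
  by (auto simp: plane_def)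

text \<open>The only place where the field has to be algebraically closed.\<close>

lemma plane_eigenvector:
  assumes f: "lin f" and P: "plane P" and inv: "\<And>v. v \<in> P \<Longrightarrow> f v \<in> P"
  obtains v c where "v \<in> P" "v \<noteq> 0" "f v = c *s v"
proof -
  obtain x y where xy: "indep2 x y" "P = span {x, y}" using P by (auto simp: plane_def)
  have mem: "x \<in> P" "y \<in> P" using xy(2) by (auto intro: span_base)
  obtain a b where fx: "f x = a *s x + b *s y"
    using inv[OF mem(1)] unfolding xy(2) span_pair by blast
  obtain c d where fy: "f y = c *s x + d *s y"
    using inv[OF mem(2)] unfolding xy(2) span_pair by blast
  show ?thesis
  proof (cases "b = 0")
    case True
    moreover have "x \<noteq> 0" using xy(1) by (auto simp: indep2_iff_independent dependent_zero)
    ultimately show ?thesis using that[OF mem(1)] fx by simp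
  next
    case False
    \<comment> \<open>\<open>l\<close> is a root of the characteristic polynomial of \<open>f\<close> on the plane.\<close>
    define s where "s = csqrt ((a + d)\<^sup>2 - 4 * (a * d - b * c))"
    define l where "l = (a + d + s) / 2"
    have "4 * (l * (l - d) - ((l - d) * a + b * c)) =
        (2 * l - (a + d))\<^sup>2 - ((a + d)\<^sup>2 - 4 * (a * d - b * c))"
      by (simp add: power2_eq_square algebra_simps)
    also have "2 * l - (a + d) = s"
    proof -
      have "2 * l = a + d + s" by (simp add: l_def)
      then show ?thesis by simp
    qed
    also have "s\<^sup>2 - ((a + d)\<^sup>2 - 4 * (a * d - b * c)) = 0" by (simp add: s_def)
    finally have "l * (l - d) - ((l - d) * a + b * c) = 0" unfolding mult_eq_0_iff by simp
    then have l: "l * (l - d) = (l - d) * a + b * c" by (simp only: right_minus_eq)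
    define v where "v = (l - d) *s x + b *s y"
    have "f v = (l - d) *s (a *s x + b *s y) + b *s (c *s x + d *s y)"
      by (simp add: v_def lin_add[OF f] lin_scale[OF f] fx fy)
    also have "\<dots> = ((l - d) * a + b * c) *s x + ((l - d) * b + b * d) *s y"
      by (simp add: algebra_simps)
    also have "\<dots> = l *s v" unfolding l[symmetric] v_def by (simp add: algebra_simps)
    finally have "f v = l *s v" .
    moreover have "v \<noteq> 0" using xy(1) False unfolding indep2_def v_def by metis
    moreover have "v \<in> P" unfolding xy(2) span_pair v_def by blast
    ultimately show ?thesis using that by blast
  qed
qed

text \<open>A non-scalar operator \<open>f\<close> on a plane has a cyclic vector \<open>v\<close>, so that an operator commuting with
  \<open>f\<close> is determined by its value \<open>a v + b f v\<close> at \<open>v\<close> and hence equals the polynomial \<open>a + b f\<close>.\<close>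

lemma plane_commutant:
  assumes P: "plane P" and f: "lin f" and g: "lin g" and h: "lin h"
    and inv: "\<And>v. v \<in> P \<Longrightarrow> f v \<in> P" "\<And>v. v \<in> P \<Longrightarrow> g v \<in> P" "\<And>v. v \<in> P \<Longrightarrow> h v \<in> P"
    and fg: "\<And>v. v \<in> P \<Longrightarrow> f (g v) = g (f v)" and fh: "\<And>v. v \<in> P \<Longrightarrow> f (h v) = h (f v)"
    and ns: "\<nexists>c. \<forall>v\<in>P. f v = c *s v" and w: "w \<in> P"
  shows "g (h w) = h (g w)"
proof -
  obtain x y where xy: "indep2 x y" "P = span {x, y}" using P by (auto simp: plane_def)
  have "\<exists>v\<in>P. indep2 v (f v)"
  proof (rule ccontr)
    assume "\<not> ?thesis"
    then have eig: "\<exists>c. f v = c *s v" if "v \<in> P" for v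
      using that dependent_pair_scale[of v "f v"] lin_zero[OF f] by (cases "v = 0") auto
    have mem: "x \<in> P" "y \<in> P" "x + y \<in> P" using xy(2) by (auto intro: span_base span_add)
    obtain a where a: "f x = a *s x" using eig[OF mem(1)] by blast
    obtain b where b: "f y = b *s y" using eig[OF mem(2)] by blast
    obtain c where c: "f (x + y) = c *s (x + y)" using eig[OF mem(3)] by blast
    have "a *s x + b *s y = c *s x + c *s y"
      using lin_add[OF f, of x y] unfolding a b c scale_right_distrib by (rule HOL.sym)
    then have "(a - c) *s x + (b - c) *s y = 0"
      unfolding scale_left_diff_distrib add_diff_add[symmetric] by simp
    then have "a - c = 0 \<and> b - c = 0" using xy(1) unfolding indep2_def by blast
    then have "a = c" "b = c" by auto
    then have "\<forall>v\<in>P. f v = c *s v"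
      unfolding xy(2) by (auto simp: span_pair lin_add[OF f] lin_scale[OF f] a b scale_right_distrib mult.commute)
    then show False using ns by blast
  qed
  then obtain v where v: "v \<in> P" "indep2 v (f v)" by blast
  have Pv: "P = span {v, f v}" using plane_spanned[OF P v(1) inv(1) v(2)] v(1) by blast
  obtain a b where gv: "g v = a *s v + b *s f v"
    using inv(2)[OF v(1)] unfolding Pv span_pair by blast
  have poly: "g u = a *s u + b *s f u" if uP: "u \<in> P" for u
  proof -
    obtain p q where u: "u = p *s v + q *s f v" using uP unfolding Pv span_pair by blast
    have "g (f v) = a *s f v + b *s f (f v)"
      using fg[OF v(1)] by (simp add: gv lin_add[OF f] lin_scale[OF f])
    then show ?thesis
      unfolding u by (simp add: lin_add[OF g] lin_scale[OF g] lin_add[OF f] lin_scale[OF f] gv algebra_simps)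
  qed
  show ?thesis
    using poly[OF w] poly[OF inv(3)[OF w]] fh[OF w] by (simp add: lin_add[OF h] lin_scale[OF h])
qed

lemma independent_family:
  fixes y :: "nat \<Rightarrow> 'v"
  assumes "\<And>x. (\<Sum>k<m. x k *s y k) = 0 \<Longrightarrow> \<forall>k<m. x k = 0"
  shows "inj_on y {..<m}" "independent (y ` {..<m})"
proof -
  show inj: "inj_on y {..<m}"
  proof (rule inj_onI, rule ccontr)
    fix i j assume ij: "i \<in> {..<m}" "j \<in> {..<m}" "y i = y j" "i \<noteq> j"
    define x :: "nat \<Rightarrow> complex" where "x k = (if k = i then 1 else if k = j then -1 else 0)" for k
    have "(\<Sum>k<m. x k *s y k) = (\<Sum>k\<in>{i, j}. x k *s y k)"
      using ij by (intro sum.mono_neutral_right) (auto simp: x_def)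
    also have "\<dots> = 0" using ij by (simp add: x_def)
    finally have "\<forall>k<m. x k = 0" by (rule assms)
    then show False using ij by (auto simp: x_def)
  qed
  show "independent (y ` {..<m})"
  proof
    assume "dependent (y ` {..<m})"
    then obtain u where u: "\<exists>v\<in>y ` {..<m}. u v \<noteq> 0" "(\<Sum>v\<in>y ` {..<m}. u v *s v) = 0"
      by (auto simp: dependent_finite)
    from u(2) have "(\<Sum>k<m. u (y k) *s y k) = 0" by (simp add: sum.reindex[OF inj])
    then have "\<forall>k<m. u (y k) = 0" by (rule assms)
    then show False using u(1) by auto
  qed
qed

text \<open>On a finite-dimensional subspace an injective operator is onto, so that a subspace preserved
  by a generator is also preserved by its inverse.\<close>

lemma invariant_subspace_onto:
  assumes f: "lin f" "\<And>v. f v = 0 \<Longrightarrow> v = 0" and U: "subspace U" "U \<subseteq> span C" "finite C"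
    and inv: "f ` U \<subseteq> U"
  shows "f ` U = U"
proof -
  obtain B where B: "B \<subseteq> U" "independent B" "U \<subseteq> span B" "card B = dim U"
    using basis_exists by blast
  have span_B: "span B = U" using B U by (simp add: span_subspace)
  have fin: "finite B" using independent_span_bound[OF U(3) B(2)] B(1) U(2) by auto
  have hom: "Vector_Spaces.linear (*s) (*s) f"
    unfolding Vector_Spaces.linear_iff using f(1) vector_space_axioms by (simp add: lin_def)
  then interpret f: Vector_Spaces.linear "(*s)" "(*s)" f .
  have inj: "inj f" using f(2) by (simp add: f.inj_iff_eq_0)
  have "independent (f ` B)" using B(2) inj
    by (intro f.independent_injective_image) (auto intro: inj_on_subset)
  moreover have "f ` B \<subseteq> span B" using inv B(1) span_B by blast
  moreover have "card (f ` B) = card B" using inj by (intro card_image) (auto intro: inj_on_subset)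
  ultimately have "span (f ` B) = U" using independent_spans_if_card fin span_B by blast
  moreover have "span (f ` B) \<subseteq> f ` U"
    using B(1) subspace_lin_image[OF f(1) U(1)] by (intro span_minimal) auto
  ultimately show ?thesis using inv by blast
qed

end

section \<open>Braid operators whose displacements have planar images\<close>

text \<open>\<open>A i\<close> is the displacement \<open>\<rho>(\<sigma>\<^sub>i) - 1\<close>. The representation space is the subspace \<open>R\<close>, not the
  whole type; \<open>image_R\<close> expresses that the operators do not act outside \<open>R\<close>.\<close>

locale corank_two_braiding = complex_space scale
  for scale :: "complex \<Rightarrow> 'v::ab_group_add \<Rightarrow> 'v" (infixr "*s" 75) +
  fixes n :: nat and A :: "nat \<Rightarrow> 'v \<Rightarrow> 'v" and R :: "'v set"
  assumes n_ge_7: "n \<ge> 7"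
    and lin_A: "lin (A i)"
    and S_injective: "\<lbrakk>1 \<le> i; i < n; v + A i v = 0\<rbrakk> \<Longrightarrow> v = 0"
    and S_surjective: "\<lbrakk>1 \<le> i; i < n\<rbrakk> \<Longrightarrow> \<exists>u. u + A i u = v"
    and A_comm: "\<lbrakk>1 \<le> i; i + 2 \<le> j; j < n\<rbrakk> \<Longrightarrow> A i (A j v) = A j (A i v)"
    and braid: "\<lbrakk>1 \<le> i; Suc i < n\<rbrakk> \<Longrightarrow> (let s = (\<lambda>i v. v + A i v) in
      s i (s (Suc i) (s i v)) = s (Suc i) (s i (s (Suc i) v)))"
    and subspace_R: "subspace R"
    and image_R: "\<lbrakk>1 \<le> i; i < n\<rbrakk> \<Longrightarrow> A i ` R = range (A i)"
    and range_subset: "\<lbrakk>1 \<le> i; i < n\<rbrakk> \<Longrightarrow> range (A i) \<subseteq> R"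
    and plane_range: "\<lbrakk>1 \<le> i; i < n\<rbrakk> \<Longrightarrow> plane (range (A i))"
    and simple: "\<lbrakk>subspace U; U \<subseteq> R; U \<noteq> {0};
      \<And>i u. \<lbrakk>1 \<le> i; i < n; u \<in> U\<rbrakk> \<Longrightarrow> A i u \<in> U\<rbrakk> \<Longrightarrow> U = R"
begin

lemmas A_add = lin_add[OF lin_A] and A_scale = lin_scale[OF lin_A]
  and A_zero = lin_zero[OF lin_A] and A_diff = lin_diff[OF lin_A] and A_sum = lin_sum[OF lin_A]

definition S :: "nat \<Rightarrow> 'v \<Rightarrow> 'v" where
  "S i v = v + A i v"

lemma lin_S: "lin (S i)"
  by (simp add: lin_def S_def A_add A_scale scale_right_distrib add_ac)

lemmas S_add = lin_add[OF lin_S] and S_scale = lin_scale[OF lin_S]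
  and S_zero = lin_zero[OF lin_S] and S_diff = lin_diff[OF lin_S]

lemma S_eq_0: "\<lbrakk>1 \<le> i; i < n; S i v = 0\<rbrakk> \<Longrightarrow> v = 0"
  using S_injective[of i v] by (simp add: S_def)

lemma S_inject: "\<lbrakk>1 \<le> i; i < n; S i u = S i v\<rbrakk> \<Longrightarrow> u = v"
  using S_eq_0[of i "u - v"] by (simp add: S_diff)

lemma S_surj: "\<lbrakk>1 \<le> i; i < n\<rbrakk> \<Longrightarrow> \<exists>u. v = S i u"
  using S_surjective[of i v] by (auto simp: S_def)

lemma S_fixed: "A i v = 0 \<Longrightarrow> S i v = v"
  by (simp add: S_def)

lemma S_A: "S i (A i v) = A i (S i v)"
  by (simp add: S_def A_add)

text \<open>The bounds are part of the relation, so that it provides all side conditions of the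
  commutation rules at once.\<close>

definition far :: "nat \<Rightarrow> nat \<Rightarrow> bool" where
  "far i j \<longleftrightarrow> 1 \<le> i \<and> i < n \<and> 1 \<le> j \<and> j < n \<and> (i + 2 \<le> j \<or> j + 2 \<le> i)"

lemma A_far_commute: "far i j \<Longrightarrow> A i (A j v) = A j (A i v)"
  using A_comm[of i j v] A_comm[of j i v] by (auto simp: far_def)

lemma S_A_far: "far i j \<Longrightarrow> S i (A j v) = A j (S i v)"
  using A_far_commute[of i j v] by (simp add: S_def A_add)

lemma S_braid: "\<lbrakk>1 \<le> i; Suc i < n\<rbrakk> \<Longrightarrow> S i (S (Suc i) (S i v)) = S (Suc i) (S i (S (Suc i) v))"
  using braid[of i v] by (simp add: S_def Let_def)

text \<open>The braid relation conjugates \<open>\<sigma>\<^sub>i\<close> to \<open>\<sigma>\<^bsub>i+1\<^esub>\<close> by \<open>\<sigma>\<^sub>i\<sigma>\<^bsub>i+1\<^esub>\<close>, and it conjugates back by \<open>\<sigma>\<^bsub>i+1\<^esub>\<sigma>\<^sub>i\<close>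
  (\<open>shift_down\<close>).\<close>

lemma shift_up:
  assumes "1 \<le> i" "Suc i < n"
  shows "S i (S (Suc i) (A i v)) = A (Suc i) (S i (S (Suc i) v))"
proof -
  let ?X = "S i (S (Suc i) v)"
  have "S i (S (Suc i) (S i v)) = ?X + S i (S (Suc i) (A i v))"
    by (simp only: S_def[of i v] S_add)
  moreover have "S (Suc i) ?X = ?X + A (Suc i) ?X" by (rule S_def)
  ultimately show ?thesis using S_braid[OF assms, of v] by simp
qed

lemma shift_down:
  assumes "1 \<le> i" "Suc i < n"
  shows "S (Suc i) (S i (A (Suc i) v)) = A i (S (Suc i) (S i v))"
proof -
  let ?X = "S (Suc i) (S i v)"
  have "S (Suc i) (S i (S (Suc i) v)) = ?X + S (Suc i) (S i (A (Suc i) v))"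
    by (simp only: S_def[of "Suc i" v] S_add)
  moreover have "S i ?X = ?X + A i ?X" by (rule S_def)
  ultimately show ?thesis using S_braid[OF assms, of v] by simp
qed

text \<open>This is \<open>\<sigma>\<^sub>i\<sigma>\<^bsub>i+1\<^esub>\<sigma>\<^sub>i\<close> minus the terms, such as \<open>1\<close> and \<open>A\<^sub>iA\<^bsub>i+1\<^esub>\<close>, that occur alike on both sides of the
  expanded braid relation.\<close>

definition E :: "nat \<Rightarrow> 'v \<Rightarrow> 'v" where
  "E i v = A i v + A i (A i v) + A i (A (Suc i) (A i v))"

lemma E_symmetric:
  assumes "1 \<le> i" "Suc i < n"
  shows "E i v = A (Suc i) v + A (Suc i) (A (Suc i) v) + A (Suc i) (A i (A (Suc i) v))"
proof -
  have "S i (S (Suc i) (S i v)) = v + A i v + A (Suc i) v + A i (A (Suc i) v) + A (Suc i) (A i v) + E i v"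
    by (simp add: S_def E_def A_add algebra_simps)
  moreover have "S (Suc i) (S i (S (Suc i) v)) =
      v + A i v + A (Suc i) v + A i (A (Suc i) v) + A (Suc i) (A i v) +
      (A (Suc i) v + A (Suc i) (A (Suc i) v) + A (Suc i) (A i (A (Suc i) v)))"
    by (simp add: S_def A_add algebra_simps)
  ultimately show ?thesis using S_braid[OF assms, of v] by simp
qed

section \<open>Distant generators\<close>

text \<open>If \<open>a\<close> and \<open>b\<close> commute and are invertible, \<open>aba = bab\<close> gives \<open>a = b\<close>.\<close>

lemma commuting_neighbours_agree:
  assumes i: "1 \<le> i" "Suc i < n" and P: "subspace P"
    and inv: "\<And>v. v \<in> P \<Longrightarrow> A i v \<in> P" "\<And>v. v \<in> P \<Longrightarrow> A (Suc i) v \<in> P"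
    and comm: "\<And>v. v \<in> P \<Longrightarrow> A i (A (Suc i) v) = A (Suc i) (A i v)"
    and v: "v \<in> P"
  shows "A i v = A (Suc i) v"
proof -
  have SP: "S (Suc i) u \<in> P" if "u \<in> P" for u
    using that inv(2) P by (simp add: S_def subspace_add)
  have SS: "S i (S (Suc i) u) = S (Suc i) (S i u)" if "u \<in> P" for u
    using comm[OF that] by (simp add: S_def A_add algebra_simps)
  have "S i (S (Suc i) (S i v)) = S (Suc i) (S i (S (Suc i) v))" by (rule S_braid[OF i])
  also have "\<dots> = S i (S (Suc i) (S (Suc i) v))" using SS[OF SP[OF v]] by simp
  finally have "S i v = S (Suc i) v" using S_inject i by (metis Suc_lessD le_SucI)
  then show ?thesis by (simp add: S_def)
qed

text \<open>A two-dimensional representation of a braid group on at least five strings is cyclic. If the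
  first generator is scalar on the plane, it commutes with the second; otherwise the third and
  the fourth, which commute with the first, commute with each other. In both cases two
  neighbours agree, and this agreement spreads along the chain: a generator commutes with all
  but its neighbours, hence with anything that agrees with one of the others.\<close>

lemma agree_on_plane:
  assumes P: "plane P" and ab: "1 \<le> a" "a + 3 \<le> b" "b < n"
    and inv: "\<And>i v. \<lbrakk>a \<le> i; i \<le> b; v \<in> P\<rbrakk> \<Longrightarrow> A i v \<in> P"
    and i: "a \<le> i" "i \<le> b" and v: "v \<in> P"
  shows "A i v = A a v"
proof -
  let ?eq = "\<lambda>k. \<forall>v\<in>P. A k v = A (Suc k) v"
  note sub = plane_subspace[OF P]
  have nb: "?eq k" if "a \<le> k" "Suc k \<le> b" "\<And>v. v \<in> P \<Longrightarrow> A k (A (Suc k) v) = A (Suc k) (A k v)" for k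
    using commuting_neighbours_agree[of k P] that sub ab inv by auto
  have "\<exists>k. a \<le> k \<and> Suc k \<le> b \<and> ?eq k"
  proof (cases "\<exists>c. \<forall>v\<in>P. A a v = c *s v")
    case True
    then obtain c where c: "\<And>v. v \<in> P \<Longrightarrow> A a v = c *s v" by blast
    have "?eq a"
      using ab inv by (intro nb) (auto simp: c A_scale)
    then show ?thesis using ab by (intro exI[of _ a]) auto
  next
    case False
    have "A (a + 2) (A (a + 3) v) = A (a + 3) (A (a + 2) v)" if "v \<in> P" for v
    proof (rule plane_commutant[OF P lin_A lin_A lin_A _ _ _ _ _ False that])
      fix v assume v: "v \<in> P"
      show "A a v \<in> P" "A (a + 2) v \<in> P" "A (a + 3) v \<in> P"
        using v ab by (auto intro: inv)
      show "A a (A (a + 2) v) = A (a + 2) (A a v)" "A a (A (a + 3) v) = A (a + 3) (A a v)"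
        using ab by (auto intro: A_comm)
    qed
    then have "?eq (a + 2)"
      using ab by (intro nb) (auto simp: eval_nat_numeral)
    then show ?thesis using ab by (intro exI[of _ "a + 2"]) auto
  qed
  then obtain k where k: "a \<le> k" "Suc k \<le> b" "?eq k" by blast
  have up: "j < b \<longrightarrow> ?eq j" if "k \<le> j" for j
    using that
  proof (induction j rule: dec_induct)
    case base
    then show ?case using k by simp
  next
    case (step j)
    show ?case
    proof
      assume b: "Suc j < b"
      then have eq: "?eq j" using step by simp
      show "?eq (Suc j)"
      proof (rule nb)
        fix v assume v: "v \<in> P"
        have v': "A (Suc (Suc j)) v \<in> P" using v b k step by (intro inv) auto
        have "A (Suc j) (A (Suc (Suc j)) v) = A j (A (Suc (Suc j)) v)" using eq v' by simp
        also have "\<dots> = A (Suc (Suc j)) (A j v)" using ab k step b by (intro A_comm) auto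
        also have "\<dots> = A (Suc (Suc j)) (A (Suc j) v)" using eq v by simp
        finally show "A (Suc j) (A (Suc (Suc j)) v) = A (Suc (Suc j)) (A (Suc j) v)" .
      qed (use k step b in auto)
    qed
  qed
  have down: "a \<le> j \<longrightarrow> ?eq j" if "j \<le> k" for j
    using that
  proof (induction j rule: inc_induct)
    case base
    then show ?case using k by simp
  next
    case (step j)
    show ?case
    proof
      assume a: "a \<le> j"
      then have eq: "?eq (Suc j)" using step by simp
      show "?eq j"
      proof (rule nb)
        fix v assume v: "v \<in> P"
        have v': "A j v \<in> P" using v a k step by (intro inv) auto
        have "A j (A (Suc j) v) = A j (A (Suc (Suc j)) v)" using eq v by simp
        also have "\<dots> = A (Suc (Suc j)) (A j v)" using ab k step a by (intro A_comm) auto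
        also have "\<dots> = A (Suc j) (A j v)" using eq v' by simp
        finally show "A j (A (Suc j) v) = A (Suc j) (A j v)" .
      qed (use k step a in auto)
    qed
  qed
  have eq: "?eq j" if "a \<le> j" "j < b" for j
    using up[of j] down[of j] that by (cases "k \<le> j") auto
  from i(1) have "i \<le> b \<longrightarrow> A i v = A a v"
  proof (induction i rule: dec_induct)
    case (step j)
    then show ?case using eq[of j] v by auto
  qed simp
  then show ?thesis using i by simp
qed

text \<open>On an invariant plane all generators agree, so an eigenvector of one of them spans an
  invariant line, which would have to be all of \<open>R\<close>.\<close>

lemma no_invariant_plane:
  assumes P: "plane P" "P \<subseteq> R"
    and inv: "\<And>i v. \<lbrakk>1 \<le> i; i < n; v \<in> P\<rbrakk> \<Longrightarrow> A i v \<in> P"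
  shows False
proof -
  have agree: "A i v = A 1 v" if "1 \<le> i" "i < n" "v \<in> P" for i v
    using agree_on_plane[OF P(1), of 1 "n - 1" i v] that n_ge_7 inv by auto
  have "A 1 v \<in> P" if "v \<in> P" for v
    using that inv[of 1] n_ge_7 by simp
  then obtain v c where v: "v \<in> P" "v \<noteq> 0" "A 1 v = c *s v"
    using plane_eigenvector[OF lin_A P(1), of 1] by blast
  have "span {v} = R"
  proof (rule simple)
    show "span {v} \<subseteq> R" using v P subspace_R by (intro span_minimal) auto
    show "span {v} \<noteq> {0}" using v span_base[of v "{v}"] by auto
    fix i u assume i: "1 \<le> i" "i < n" and "u \<in> span {v}"
    then obtain k where "u = k *s v" by (auto simp: span_singleton)
    then show "A i u \<in> span {v}"
      using agree[OF i v(1)] v(3) by (simp add: A_scale span_scale span_base)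
  qed simp
  \<comment> \<open>The degenerate pair \<open>v\<close>, \<open>v\<close> spans the line, so it would be independent.\<close>
  then have "P \<subseteq> span {v, v}" using P(2) by simp
  with P(1) have "indep2 v v" by (rule plane_generators_indep2)
  then show False by (simp add: indep2_iff_independent)
qed

text \<open>The operator \<open>D = A\<^sub>1A\<^sub>3\<close> is central. Its expression as \<open>A\<^sub>1A\<^sub>k\<close> shows that
  it commutes with \<open>A\<^sub>k\<close> for \<open>k \<ge> 3\<close>; for \<open>k = 2\<close> it is rewritten as \<open>A\<^sub>2A\<^bsub>n-1\<^esub>\<close>, using the other end
  of the chain.\<close>

lemma A_far_zero:
  assumes "far i j"
  shows "A i (A j v) = 0"
proof -
  define D where "D v = A 1 (A 3 v)" for v
  \<comment> \<open>On \<open>V\<^sub>1\<close> the generators from the third on agree, hence so do their products with \<open>A 1\<close>.\<close>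
  have D1: "A 1 (A j v) = D v" if j: "3 \<le> j" "j < n" for j v
  proof -
    have "A j (A 1 v) = A 3 (A 1 v)"
    proof (rule agree_on_plane[where P = "range (A 1)" and b = "n - 1"])
      fix k w assume k: "3 \<le> k" "k \<le> n - 1" and "w \<in> range (A 1)"
      then obtain u where "w = A 1 u" by blast
      then show "A k w \<in> range (A 1)" using A_comm[of 1 k u, symmetric] k n_ge_7 by auto
    qed (use n_ge_7 j plane_range[of 1] in auto)
    then show ?thesis using A_comm[of 1 j v] A_comm[of 1 3 v] j n_ge_7 by (simp add: D_def)
  qed
  \<comment> \<open>The same at the other end of the chain, where the value is \<open>A 1 (A (n - 1) v)\<close>.\<close>
  have D2: "A j (A (n - 1) v) = D v" if j: "1 \<le> j" "j \<le> n - 3" for j v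
  proof -
    have "A j (A (n - 1) v) = A 1 (A (n - 1) v)"
    proof (rule agree_on_plane[where P = "range (A (n - 1))" and b = "n - 3"])
      fix k w assume k: "1 \<le> k" "k \<le> n - 3" and "w \<in> range (A (n - 1))"
      then obtain u where "w = A (n - 1) u" by blast
      then show "A k w \<in> range (A (n - 1))" using A_comm[of k "n - 1" u] k n_ge_7 by auto
    qed (use n_ge_7 j plane_range[of "n - 1"] in auto)
    then show ?thesis using D1[of "n - 1" v] n_ge_7 by simp
  qed
  have D_comm: "A k (D v) = D (A k v)" if k: "1 \<le> k" "k < n" for k v
  proof -
    consider "k = 1" | "k = 2" | "k \<ge> 3" using k by linarith
    then show ?thesis
    proof cases
      case 1
      then show ?thesis using A_comm[of 1 3 "v"] n_ge_7 by (simp add: D_def)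
    next
      case 2
      then show ?thesis
        using A_comm[of 2 "n - 1" v] n_ge_7 D2[of 2 v, symmetric] D2[of 2 "A 2 v", symmetric] by simp
    next
      case 3
      then show ?thesis
        using A_comm[of 1 k "A k v"] k D1[of k v, symmetric] D1[of k "A k v", symmetric] by simp
    qed
  qed
  have lin_D: "lin D" using lin_comp[OF lin_A[of 1] lin_A[of 3]] by (simp add: D_def[abs_def])
  have "range D = {0}"
  proof (rule ccontr)
    assume ne: "range D \<noteq> {0}"
    have sub: "range D \<subseteq> range (A 1)" unfolding D_def by auto
    have R1: "range (A 1) \<subseteq> R" using range_subset[of 1] n_ge_7 by simp
    have "range D = R"
    proof (rule simple)
      show "subspace (range D)" by (rule subspace_lin_image[OF lin_D subspace_UNIV])
      show "range D \<subseteq> R" using sub R1 by blast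
      show "range D \<noteq> {0}" by (rule ne)
      show "A k u \<in> range D" if "1 \<le> k" "k < n" "u \<in> range D" for k u
        using that D_comm by auto
    qed
    then have eq: "range (A 1) = R" using sub R1 by blast
    show False
    proof (rule no_invariant_plane)
      show "plane (range (A 1))" using plane_range[of 1] n_ge_7 by simp
      show "range (A 1) \<subseteq> R" by (rule R1)
      show "A k u \<in> range (A 1)" if "1 \<le> k" "k < n" "u \<in> range (A 1)" for k u
        using that range_subset[of k] unfolding eq by blast
    qed
  qed
  then have D0: "D v = 0" for v by blast
  have zero: "i + 2 \<le> j \<and> j < n \<longrightarrow> (\<forall>v. A i (A j v) = 0)" if "1 \<le> i" for i j
    using that
  proof (induction i rule: dec_induct)
    case base
    then show ?case using D1[of j] D0 by simp
  next
    case (step i)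
    show ?case
    proof (intro impI allI, elim conjE)
      fix v assume j: "Suc i + 2 \<le> j" "j < n"
      obtain u w where "v = S i u" "u = S (Suc i) w"
        using S_surj[of i v] S_surj[of "Suc i"] step j by fastforce
      then have v: "v = S i (S (Suc i) w)" by simp
      have f: "far i j" "far (Suc i) j" using step j by (auto simp: far_def)
      have "A (Suc i) (A j v) = A (Suc i) (S i (S (Suc i) (A j w)))"
        using f by (simp add: v S_A_far)
      also have "\<dots> = S i (S (Suc i) (A i (A j w)))"
        using step j by (subst shift_up) auto
      also have "\<dots> = 0" using step j by (simp add: S_zero)
      finally show "A (Suc i) (A j v) = 0" .
    qed
  qed
  show ?thesis
    using assms zero[of i j] zero[of j i] A_far_commute[of i j v] by (auto simp: far_def)
qed

section \<open>Neighbouring generators\<close>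

text \<open>Conjugation by \<open>\<sigma>\<^sub>i\<sigma>\<^bsub>i+1\<^esub>\<sigma>\<^bsub>i+2\<^esub>\<close> moves the pair \<open>(\<sigma>\<^sub>i, \<sigma>\<^bsub>i+1\<^esub>)\<close> to \<open>(\<sigma>\<^bsub>i+1\<^esub>, \<sigma>\<^bsub>i+2\<^esub>)\<close>.\<close>

lemma E_vanishes_everywhere:
  assumes "\<And>v. E 1 v = 0" "1 \<le> i" "Suc i < n"
  shows "E i v = 0"
proof -
  from assms(2) have "Suc i < n \<longrightarrow> (\<forall>v. E i v = 0)"
  proof (induction i rule: dec_induct)
    case base
    then show ?case using assms(1) by simp
  next
    case (step i)
    show ?case
    proof (intro impI allI)
      fix v assume i: "Suc (Suc i) < n"
      \<comment> \<open>\<open>G\<close> moves two neighbouring generators one step up the chain.\<close>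
      define G where "G w = S i (S (Suc i) (S (Suc (Suc i)) w))" for w
      have G_add: "G (u + w) = G u + G w" for u w by (simp add: G_def S_add)
      have far: "far i (Suc (Suc i))" "far (Suc (Suc i)) i" using step i by (auto simp: far_def)
      have G1: "G (A i w) = A (Suc i) (G w)" for w
        using shift_up[of i "S (Suc (Suc i)) w"] step i far by (simp add: G_def S_A_far)
      have G2: "G (A (Suc i) w) = A (Suc (Suc i)) (G w)" for w
        using shift_up[of "Suc i" w] step i far by (simp add: G_def S_A_far)
      have "\<exists>w. v = G w"
        using S_surj[of i] S_surj[of "Suc i"] S_surj[of "Suc (Suc i)"] step i
        unfolding G_def by (metis Suc_lessD le_SucI)
      then obtain w where "v = G w" by blast
      then have "E (Suc i) v = G (E i w)" by (simp add: E_def G_add G1 G2)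
      moreover have "E i w = 0" using step i by simp
      ultimately show "E (Suc i) v = 0" by (simp add: G_def S_zero)
    qed
  qed
  then show ?thesis using assms by simp
qed

text \<open>If all \<open>E\<^sub>i\<close> vanished, the translates \<open>y\<^sub>0 = v\<close>, \<open>y\<^sub>i = A\<^bsub>i+1\<^esub>y\<^bsub>i-1\<^esub>\<close> of an eigenvector \<open>v \<in> V\<^sub>1\<close> would
  satisfy the relations of the reduced Burau representation, up to scaling: \<open>A\<^bsub>i+1\<^esub>\<close> multiplies
  \<open>y\<^sub>i\<close> by the eigenvalue \<open>c\<close>, maps \<open>y\<^bsub>i+1\<^esub>\<close> to \<open>-(1 + c) y\<^sub>i\<close> and \<open>y\<^bsub>i-1\<^esub>\<close> to \<open>y\<^sub>i\<close>, and kills the others.\<close>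

lemma E_1_nonzero: "\<exists>v. E 1 v \<noteq> 0"
proof (rule ccontr)
  assume "\<nexists>v. E 1 v \<noteq> 0"
  then have E0: "E i v = 0" if "1 \<le> i" "Suc i < n" for i v
    using E_vanishes_everywhere that by blast
  have P: "plane (range (A 1))" using plane_range[of 1] n_ge_7 by simp
  obtain v c where v: "v \<in> range (A 1)" "v \<noteq> 0" "A 1 v = c *s v"
    using plane_eigenvector[OF lin_A P, of 1] by blast
  define y where "y = rec_nat v (\<lambda>i. A (Suc (Suc i)))"
  have y0: "y 0 = v" and ySuc: "y (Suc i) = A (Suc (Suc i)) (y i)" for i
    by (simp_all add: y_def)
  have y_range: "y i \<in> range (A (Suc i))" for i
    using v by (cases i) (auto simp: y0 ySuc)
  have y_back: "A (Suc i) (y (Suc i)) = (- 1 - c) *s y i"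
    if "Suc (Suc i) < n" "A (Suc i) (y i) = c *s y i" for i
  proof -
    obtain u where u: "y i = A (Suc i) u" using y_range[of i] by blast
    have "E (Suc i) u = 0" using E0 that by simp
    then have "y i + A (Suc i) (y i) + A (Suc i) (y (Suc i)) = 0"
      unfolding E_def ySuc by (simp flip: u)
    then show ?thesis using that(2) by (simp add: algebra_simps eq_neg_iff_add_eq_0)
  qed
  have y_eigen: "Suc i < n \<longrightarrow> A (Suc i) (y i) = c *s y i" for i
  proof (induction i)
    case 0
    then show ?case using v by (simp add: y0)
  next
    case (Suc i)
    show ?case
    proof
      assume i: "Suc (Suc i) < n"
      let ?B = "A (Suc (Suc i))"
      have "E (Suc i) (y i) = 0" using E0 i by simp
      then have "?B (y i) + ?B (?B (y i)) + ?B (A (Suc i) (?B (y i))) = 0"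
        using E_symmetric[of "Suc i" "y i"] i by simp
      then have "y (Suc i) + ?B (y (Suc i)) + ?B (A (Suc i) (y (Suc i))) = 0"
        by (simp only: ySuc)
      moreover have "?B (A (Suc i) (y (Suc i))) = (- 1 - c) *s y (Suc i)"
        using y_back[of i] Suc i by (simp add: A_scale ySuc)
      ultimately show "?B (y (Suc i)) = c *s y (Suc i)"
        by (simp add: algebra_simps)
    qed
  qed
  let ?U = "span (y ` {..<n - 1})"
  have "?U = R"
  proof (rule simple)
    have "y i \<in> R" if "Suc i < n" for i using y_range[of i] range_subset[of "Suc i"] that by auto
    then show "?U \<subseteq> R" by (intro span_minimal subspace_R) auto
    have "v \<in> ?U" using y0 n_ge_7 by (intro span_base image_eqI[of _ _ 0]) auto
    then show "?U \<noteq> {0}" using v by blast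
    fix j u assume j: "1 \<le> j" "j < n" and u: "u \<in> ?U"
    have y_U: "y i \<in> ?U" if "Suc i < n" for i using that by (auto intro: span_base)
    have "A j (y i) \<in> ?U" if i: "Suc i < n" for i
    proof -
      consider "j = Suc i" | "j = Suc (Suc i)" | "j = i" | "far j (Suc i)"
        using j i unfolding far_def by linarith
      then show ?thesis
      proof cases
        case 1
        then show ?thesis using y_eigen[of i] i y_U by (simp add: span_scale)
      next
        case 2
        then show ?thesis using y_U[of "Suc i"] j by (simp flip: ySuc)
      next
        case 3
        then obtain m where "j = Suc m" "i = Suc m" using j by (cases j) auto
        then show ?thesis using y_back[of m] y_eigen[of m] y_U[of m] i by (simp add: span_scale)
      next
        case 4
        then have "A j (y i) = 0" using y_range[of i] A_far_zero by auto
        then show ?thesis by (simp add: span_zero)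
      qed
    qed
    then have "span (A j ` y ` {..<n - 1}) \<subseteq> ?U" by (intro span_minimal) auto
    then show "A j u \<in> ?U" using lin_image_span[OF lin_A] u by blast
  qed simp
  then have "range (A 1) \<subseteq> span (A 1 ` y ` {..<n - 1})"
    using image_R[of 1] lin_image_span[OF lin_A, of 1] n_ge_7 by auto
  \<comment> \<open>Only \<open>y 0\<close> and \<open>y 1\<close> survive under \<open>A 1\<close>, and both are mapped to multiples of \<open>v\<close>.\<close>
  also have "\<dots> \<subseteq> span {v, v}"
  proof (rule span_minimal)
    have "A 1 (y i) \<in> span {v, v}" if i: "Suc i < n" for i
    proof -
      consider "i = 0" | "i = 1" | "far 1 (Suc i)"
        using i n_ge_7 unfolding far_def by linarith
      then show ?thesis
      proof cases
        case 1
        then show ?thesis using v by (simp add: y0 span_scale span_base)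
      next
        case 2
        then show ?thesis using y_back[of 0] y_eigen[of 0] n_ge_7 by (simp add: y0 span_scale span_base)
      next
        case 3
        then have "A 1 (y i) = 0" using y_range[of i] A_far_zero by auto
        then show ?thesis by (simp add: span_zero)
      qed
    qed
    then show "A 1 ` y ` {..<n - 1} \<subseteq> span {v, v}" by auto
  qed simp
  finally have "indep2 v v" by (rule plane_generators_indep2[OF P])
  then show False by (simp add: indep2_iff_independent)
qed

text \<open>Otherwise \<open>V\<^sub>1 = V\<^sub>2\<close>, and this plane is preserved by \<open>A\<^sub>1\<close> and \<open>A\<^sub>2\<close> and killed by all other
  \<open>A\<^sub>j\<close>.\<close>

lemma image_intersection_line:
  assumes f: "f \<in> range (A 1)" "f \<in> range (A 2)" and g: "g \<in> range (A 1)" "g \<in> range (A 2)"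
    and "f \<noteq> 0"
  obtains c where "g = c *s f"
proof -
  have "\<not> indep2 f g"
  proof
    assume ind: "indep2 f g"
    let ?P = "span {f, g}"
    have P1: "range (A 1) = ?P" using plane_spanned[OF plane_range f(1) g(1) ind] n_ge_7 by simp
    have P2: "range (A 2) = ?P" using plane_spanned[OF plane_range f(2) g(2) ind] n_ge_7 by simp
    show False
    proof (rule no_invariant_plane)
      show "plane ?P" using ind by (auto simp: plane_def)
      show "?P \<subseteq> R" using range_subset[of 1] n_ge_7 by (simp add: P1 del: One_nat_def)
      fix i v assume i: "1 \<le> i" "i < n" and v: "v \<in> ?P"
      consider "i = 1" | "i = 2" | "far i 1" using i n_ge_7 unfolding far_def by linarith
      then show "A i v \<in> ?P"
      proof cases
        case 3
        then have "A i v = 0" using v unfolding P1[symmetric] by (auto simp: A_far_zero)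
        then show ?thesis by (simp add: span_zero)
      qed (use P1 P2 in auto)
    qed
  qed
  then show ?thesis using dependent_pair_scale \<open>f \<noteq> 0\<close> that by blast
qed

section \<open>The standard basis\<close>

text \<open>Let \<open>f\<close> span \<open>V\<^sub>1 \<inter> V\<^sub>2\<close>. The half twist \<open>S\<^sub>1S\<^sub>2S\<^sub>1\<close> interchanges \<open>V\<^sub>1\<close> and \<open>V\<^sub>2\<close>, so it multiplies \<open>f\<close>
  by a scalar \<open>t\<close>. Conjugating by \<open>S\<^sub>1S\<^sub>2S\<^sub>3\<close> shows \<open>A\<^sub>1S\<^sub>2f = 0\<close>; with this, the half twist acts on
  \<open>f\<close> as \<open>S\<^sub>2\<^sup>2\<close>, and since it conjugates \<open>S\<^sub>2\<^sup>2\<close> to \<open>S\<^sub>1\<^sup>2\<close>, also \<open>S\<^sub>1\<^sup>2f = t f\<close>. The vector wanted is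
  \<open>e = S\<^sub>1\<^sup>-\<^sup>1f\<close>, and \<open>A\<^sub>2e = 0\<close> is again \<open>A\<^sub>1S\<^sub>2f = 0\<close>, conjugated by \<open>S\<^sub>2S\<^sub>1\<close>.\<close>

lemma stabilised_eigenvector:
  obtains e t where "e \<noteq> 0" "e \<in> R" "t \<noteq> 0" "S 1 (S 1 e) = t *s e"
    "\<And>j. \<lbrakk>2 \<le> j; j < n\<rbrakk> \<Longrightarrow> A j e = 0"
proof -
  have n: "1 < n" "2 < n" "3 < n" and far: "far 1 3" "far 3 1"
    using n_ge_7 by (auto simp: far_def)
  have up1: "S 1 (S 2 (A 1 v)) = A 2 (S 1 (S 2 v))" for v
    using shift_up[of 1 v] n by (simp add: numeral_2_eq_2)
  have up2: "S 2 (S 3 (A 2 v)) = A 3 (S 2 (S 3 v))" for v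
    using shift_up[of 2 v] n by (simp add: eval_nat_numeral)
  have down1: "S 2 (S 1 (A 2 v)) = A 1 (S 2 (S 1 v))" for v
    using shift_down[of 1 v] n by (simp add: numeral_2_eq_2)
  have braid1: "S 1 (S 2 (S 1 v)) = S 2 (S 1 (S 2 v))" for v
    using S_braid[of 1 v] n by (simp add: numeral_2_eq_2)
  note One_nat_def [simp del]
  obtain u where "E 1 u \<noteq> 0" using E_1_nonzero by blast
  define f where "f = E 1 u"
  have f0: "f \<noteq> 0" using \<open>E 1 u \<noteq> 0\<close> by (simp add: f_def)
  have "f = A 1 (u + A 1 u + A 2 (A 1 u))"
    by (simp add: f_def E_def A_add)
  then obtain a where a: "f = A 1 a" by blast
  have "f = A 2 (u + A 2 u + A 1 (A 2 u))"
    using E_symmetric[of 1 u] n by (simp add: f_def A_add)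
  then obtain b where b: "f = A 2 b" by blast
  have "S 1 (S 2 (S 1 f)) \<in> range (A 2)" by (simp add: a S_A up1)
  moreover have "S 1 (S 2 (S 1 f)) \<in> range (A 1)" by (simp add: b braid1 S_A down1)
  ultimately obtain t where t: "S 1 (S 2 (S 1 f)) = t *s f"
    using image_intersection_line[of f "S 1 (S 2 (S 1 f))"] a b f0 by blast
  have t0: "t \<noteq> 0"
  proof
    assume "t = 0"
    then have "S 1 (S 2 (S 1 f)) = 0" using t by simp
    then have "f = 0"
      using S_eq_0[of 1 "S 2 (S 1 f)"] S_eq_0[of 2 "S 1 f"] S_eq_0[of 1 f] n by simp
    then show False using f0 by simp
  qed
  have "S 1 (A 1 (S 2 f)) = 0"
  proof -
    have "S 3 f = f" using far by (simp add: a S_fixed A_far_zero)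
    then have "S 1 (A 1 (S 2 f)) = A 1 (S 1 (S 2 (S 3 f)))" by (simp add: S_A)
    also have "S 1 (S 2 (S 3 f)) = A 3 (S 1 (S 2 (S 3 b)))"
      using far by (simp add: b up2 S_A_far)
    finally show ?thesis using far by (simp add: A_far_zero)
  qed
  then have A1: "A 1 (S 2 f) = 0" using S_eq_0[of 1 "A 1 (S 2 f)"] n by simp
  have S22: "S 2 (S 2 f) = t *s f"
    using t A1 by (simp add: braid1 S_fixed)
  have S11: "S 1 (S 1 f) = t *s f"
  proof -
    \<comment> \<open>The braid relation, used twice, moves \<open>S 2\<close> squared through the half twist.\<close>
    have "t *s S 1 (S 1 f) = S 1 (S 1 (S 1 (S 2 (S 1 f))))" by (simp add: t S_scale)
    also have "\<dots> = S 1 (S 2 (S 1 (S 2 (S 2 f))))"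
      by (simp add: braid1)
    also have "\<dots> = t *s t *s f" by (simp add: S22 S_scale t)
    finally show ?thesis using t0 scale_left_imp_eq by blast
  qed
  obtain e where e: "f = S 1 e" using S_surj[of 1 f] n by auto
  have "e = A 1 (a - e)" using e a by (simp add: A_diff S_def algebra_simps)
  then have eR: "e \<in> R" using range_subset[of 1] n by auto
  have "S 1 (S 1 e) = t *s e"
  proof -
    have "S 1 (S 1 (S 1 e)) = S 1 (t *s e)" using S11 by (simp add: e S_scale)
    then show ?thesis using S_inject[of 1 "S 1 (S 1 e)"] n by blast
  qed
  moreover have "A j e = 0" if j: "2 \<le> j" "j < n" for j
  proof (cases "j = 2")
    case True
    have "S 2 (S 1 (A 2 e)) = 0" using A1 by (simp add: down1 flip: e)
    then show ?thesis
      using S_eq_0[of 2 "S 1 (A 2 e)"] S_eq_0[of 1 "A 2 e"] n True by simp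
  next
    case False
    then have "far 1 j" "far j 1" using j by (auto simp: far_def)
    then have "S 1 (A j e) = 0" by (simp add: S_A_far A_far_zero a flip: e)
    then show ?thesis using S_eq_0[of 1 "A j e"] n by simp
  qed
  moreover have "e \<noteq> 0" using f0 e by (auto simp: S_zero)
  ultimately show ?thesis using that eR t0 by blast
qed

text \<open>The basis is counted from 0, so \<open>S\<^bsub>m+1\<^esub>\<close> interchanges \<open>y\<^sub>m\<close> and \<open>y\<^bsub>m+1\<^esub>\<close> up to the factor \<open>t\<close>. For
  independence, apply \<open>A\<^bsub>m+1\<^esub>\<close> to a linear relation: only the two terms with \<open>y\<^sub>m\<close> and \<open>y\<^bsub>m+1\<^esub>\<close>
  survive, and their images have to span the plane \<open>V\<^bsub>m+1\<^esub>\<close>.\<close>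

theorem standard_basis:
  obtains y t where "t \<noteq> 0" "t \<noteq> 1" "span (y ` {..<n}) = R"
    "\<And>x. (\<Sum>k<n. x k *s y k) = 0 \<Longrightarrow> \<forall>k<n. x k = 0"
    "\<And>m. Suc m < n \<Longrightarrow> S (Suc m) (y m) = y (Suc m)"
    "\<And>m. Suc m < n \<Longrightarrow> S (Suc m) (y (Suc m)) = t *s y m"
    "\<And>m k. \<lbrakk>Suc m < n; k < n; k \<noteq> m; k \<noteq> Suc m\<rbrakk> \<Longrightarrow> S (Suc m) (y k) = y k"
proof -
  obtain e t where e: "e \<noteq> 0" "e \<in> R" "t \<noteq> 0" "S 1 (S 1 e) = t *s e"
    "\<And>j. \<lbrakk>2 \<le> j; j < n\<rbrakk> \<Longrightarrow> A j e = 0"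
    using stabilised_eigenvector by blast
  define y where "y = rec_nat e (\<lambda>k. S (Suc k))"
  have y0: "y 0 = e" and ySuc: "y (Suc k) = S (Suc k) (y k)" for k by (simp_all add: y_def)
  have kill: "\<forall>m. Suc m < n \<longrightarrow> m \<noteq> k \<longrightarrow> Suc m \<noteq> k \<longrightarrow> A (Suc m) (y k) = 0" if "k < n" for k
    using that
  proof (induction k rule: less_induct)
    case (less k)
    show ?case
    proof (intro allI impI)
      fix m assume m: "Suc m < n" "m \<noteq> k" "Suc m \<noteq> k"
      show "A (Suc m) (y k) = 0"
      proof (cases k)
        case 0
        then show ?thesis using e(5)[of "Suc m"] m by (simp add: y0)
      next
        case (Suc l)
        show ?thesis
        proof (cases "Suc m = l")
          case True
          have "A (Suc l) (y m) = 0" using less m True Suc by simp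
          then have "S (Suc l) (S l (A (Suc l) (y m))) = 0" by (simp add: S_zero)
          then have "A l (S (Suc l) (S l (y m))) = 0"
            using shift_down[of l "y m"] less True Suc by simp
          then show ?thesis using ySuc[of m] True by (simp add: Suc ySuc[of l])
        next
          case False
          then have "far (Suc l) (Suc m)" using m Suc less by (auto simp: far_def)
          moreover have "A (Suc m) (y l) = 0" using less m False Suc by simp
          ultimately show ?thesis
            using S_A_far[of "Suc l" "Suc m" "y l"] by (simp add: Suc ySuc S_zero)
        qed
      qed
    qed
  qed
  have fix_y: "S (Suc m) (y k) = y k" if "Suc m < n" "k < n" "k \<noteq> m" "k \<noteq> Suc m" for m k
    using kill[of k] that by (auto intro: S_fixed)
  have swap: "Suc m < n \<longrightarrow> S (Suc m) (y (Suc m)) = t *s y m" for m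
  proof (induction m)
    case 0
    then show ?case using e(4) by (simp add: y0 ySuc)
  next
    case (Suc m)
    show ?case
    proof
      assume m: "Suc (Suc m) < n"
      let ?i = "Suc m" and ?j = "Suc (Suc m)"
      have braid: "S ?i (S ?j (S ?i v)) = S ?j (S ?i (S ?j v))" for v
        using m by (intro S_braid) auto
      have "S ?j (y m) = y m" using m by (intro fix_y) auto
      then have "S ?j (y ?j) = S ?j (S ?j (S ?i (S ?j (y m))))" by (simp add: ySuc)
      also have "\<dots> = S ?i (S ?j (S ?i (S ?i (y m))))" by (simp flip: braid)
      also have "\<dots> = t *s S ?i (S ?j (y m))" using Suc m by (simp add: ySuc S_scale)
      also have "\<dots> = t *s y ?i" using \<open>S ?j (y m) = y m\<close> by (simp add: ySuc)
      finally show "S ?j (y ?j) = t *s y ?i" .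
    qed
  qed
  let ?U = "span (y ` {..<n})"
  have S_y: "S (Suc m) (y k) \<in> ?U" if m: "Suc m < n" and k: "k < n" for m k
  proof -
    consider "k = m" | "k = Suc m" | "k \<noteq> m" "k \<noteq> Suc m" by blast
    then show ?thesis
    proof cases
      case 1
      then show ?thesis using m by (auto intro!: span_base simp flip: ySuc)
    next
      case 2
      moreover have "y m \<in> ?U" using m by (intro span_base) auto
      ultimately show ?thesis using m swap[of m] by (simp add: span_scale)
    next
      case 3
      then show ?thesis using fix_y[OF m k] k by (auto intro!: span_base)
    qed
  qed
  have A_y: "A (Suc m) (y k) \<in> ?U" if "Suc m < n" "k < n" for m k
  proof -
    have "A (Suc m) (y k) = S (Suc m) (y k) - y k" by (simp add: S_def)
    then show ?thesis using S_y[OF that] that by (auto intro!: span_diff intro: span_base)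
  qed
  have "k < n \<longrightarrow> y k \<in> R" for k
  proof (induction k)
    case (Suc k)
    then show ?case
      using range_subset[of "Suc k"] subspace_R by (auto simp: ySuc S_def intro!: subspace_add)
  qed (simp add: y0 e)
  then have UR: "?U \<subseteq> R" by (intro span_minimal subspace_R) auto
  have U: "?U = R"
  proof (rule simple[OF _ UR])
    have "e \<in> ?U" using n_ge_7 y0 by (intro span_base image_eqI[of _ _ 0]) auto
    then show "?U \<noteq> {0}" using e by blast
    fix i u assume i: "1 \<le> i" "i < n" and u: "u \<in> ?U"
    obtain m where m: "i = Suc m" using i by (cases i) auto
    have "span (A i ` y ` {..<n}) \<subseteq> ?U" using A_y i m by (intro span_minimal) auto
    then show "A i u \<in> ?U" using lin_image_span[OF lin_A] u by blast
  qed simp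
  have ind: "indep2 (A (Suc m) (y m)) (A (Suc m) (y (Suc m)))" if m: "Suc m < n" for m
  proof (rule plane_generators_indep2)
    let ?Q = "span {A (Suc m) (y m), A (Suc m) (y (Suc m))}"
    show "plane (range (A (Suc m)))" using m by (intro plane_range) auto
    have "range (A (Suc m)) \<subseteq> span (A (Suc m) ` y ` {..<n})"
      using image_R[of "Suc m"] lin_image_span[OF lin_A, of "Suc m"] m U by auto
    also have "\<dots> \<subseteq> ?Q"
    proof (rule span_minimal)
      have "A (Suc m) (y k) \<in> ?Q" if "k < n" for k
        using kill[OF that] m by (cases "k = m \<or> k = Suc m") (auto intro: span_base span_zero)
      then show "A (Suc m) ` y ` {..<n} \<subseteq> ?Q" by auto
    qed simp
    finally show "range (A (Suc m)) \<subseteq> ?Q" .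
  qed
  have "t \<noteq> 1"
  proof
    assume "t = 1"
    then have "y 1 + A 1 (y 1) = y 0" using swap[of 0] n_ge_7 by (simp add: S_def)
    moreover have "y 1 = y 0 + A 1 (y 0)" using ySuc[of 0] by (simp add: S_def)
    ultimately have "1 *s A 1 (y 0) + 1 *s A 1 (y 1) = 0" by simp
    moreover have "indep2 (A 1 (y 0)) (A 1 (y 1))" using ind[of 0] n_ge_7 by simp
    ultimately have "(1 :: complex) = 0" unfolding indep2_def by blast
    then show False by simp
  qed
  moreover have "\<forall>k<n. x k = 0" if x: "(\<Sum>k<n. x k *s y k) = 0" for x
  proof -
    have pair: "x m = 0 \<and> x (Suc m) = 0" if m: "Suc m < n" for m
    proof -
      have "0 = A (Suc m) (\<Sum>k<n. x k *s y k)" by (simp add: x A_zero)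
      also have "\<dots> = (\<Sum>k<n. x k *s A (Suc m) (y k))" by (simp add: A_sum A_scale)
      also have "\<dots> = (\<Sum>k\<in>{m, Suc m}. x k *s A (Suc m) (y k))"
        using kill m by (intro sum.mono_neutral_right) auto
      also have "\<dots> = x m *s A (Suc m) (y m) + x (Suc m) *s A (Suc m) (y (Suc m))" by simp
      finally show ?thesis using ind[OF m] unfolding indep2_def by metis
    qed
    show ?thesis
    proof (intro allI impI)
      fix k assume "k < n"
      then show "x k = 0" using pair[of k] pair[of "k - 1"] n_ge_7 by (cases k) auto
    qed
  qed
  ultimately show ?thesis using that[of t y] e(3) U ySuc swap fix_y by auto
qed

end

section \<open>Matrices acting on functions\<close>

definition fscale :: "complex \<Rightarrow> (nat \<Rightarrow> complex) \<Rightarrow> nat \<Rightarrow> complex" where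
  "fscale c f = (\<lambda>i. c * f i)"

lemma fscale_apply [simp]: "fscale c f i = c * f i"
  by (simp add: fscale_def)

interpretation fun_space: complex_space fscale
  by unfold_locales (auto simp: fun_eq_iff algebra_simps)

lemma sum_fun_apply: "(\<Sum>k\<in>K. f k) i = (\<Sum>k\<in>K. f k i :: complex)"
  by (induction K rule: infinite_finite_induct) auto

definition coords :: "nat \<Rightarrow> (nat \<Rightarrow> complex) set" where
  "coords r = {f. \<forall>i\<ge>r. f i = 0}"

definition extend :: "nat \<Rightarrow> complex vec \<Rightarrow> nat \<Rightarrow> complex" where
  "extend r v = (\<lambda>i. if i < r then v $ i else 0)"

definition act :: "nat \<Rightarrow> complex mat \<Rightarrow> (nat \<Rightarrow> complex) \<Rightarrow> nat \<Rightarrow> complex" where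
  "act r M f = extend r (M *\<^sub>v vec r f)"

lemma vec_extend: "v \<in> carrier_vec r \<Longrightarrow> vec r (extend r v) = v"
  by (auto simp: extend_def)

lemma extend_vec: "f \<in> coords r \<Longrightarrow> extend r (vec r f) = f"
  by (auto simp: extend_def coords_def fun_eq_iff not_less)

lemma extend_coords: "extend r v \<in> coords r"
  by (simp add: extend_def coords_def)

lemma subspace_coords: "fun_space.subspace (coords r)"
  by (auto simp: fun_space.subspace_def coords_def)

lemma vec_plus: "vec r (f + g) = vec r f + vec r g"
  and vec_fscale: "vec r (fscale c f) = c \<cdot>\<^sub>v vec r f"
  and vec_zero: "vec r 0 = 0\<^sub>v r"
  by auto

lemma extend_plus:
  "\<lbrakk>v \<in> carrier_vec r; w \<in> carrier_vec r\<rbrakk> \<Longrightarrow> extend r (v + w) = extend r v + extend r w"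
  and extend_smult: "v \<in> carrier_vec r \<Longrightarrow> extend r (c \<cdot>\<^sub>v v) = fscale c (extend r v)"
  and extend_zero: "extend r (0\<^sub>v r) = 0"
  by (auto simp: extend_def fun_eq_iff)

lemma lin_act: "M \<in> carrier_mat r r \<Longrightarrow> fun_space.lin (act r M)"
  unfolding fun_space.lin_def act_def
  by (auto simp: vec_plus vec_fscale mult_add_distrib_mat_vec[of _ r r] mult_mat_vec[of _ r r]
      extend_plus extend_smult)

text \<open>Unlike \<open>act\<close>, which kills the coordinates from \<open>r\<close> on, this leaves them fixed and so turns
  invertible matrices into invertible operators.\<close>

definition gact :: "nat \<Rightarrow> complex mat \<Rightarrow> (nat \<Rightarrow> complex) \<Rightarrow> nat \<Rightarrow> complex" where
  "gact r M f = f + act r (M - 1\<^sub>m r) f"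

lemma gact_apply:
  "M \<in> carrier_mat r r \<Longrightarrow> gact r M f i = (if i < r then (M *\<^sub>v vec r f) $ i else f i)"
  by (simp add: gact_def act_def extend_def minus_mult_distrib_mat_vec[of _ r r])

lemma vec_gact: "M \<in> carrier_mat r r \<Longrightarrow> vec r (gact r M f) = M *\<^sub>v vec r f"
  by (auto simp: gact_apply)

lemma gact_mult:
  "\<lbrakk>M \<in> carrier_mat r r; N \<in> carrier_mat r r\<rbrakk> \<Longrightarrow> gact r (M * N) f = gact r M (gact r N f)"
  by (auto simp: fun_eq_iff gact_apply vec_gact)

lemma gact_mult3:
  "\<lbrakk>K \<in> carrier_mat r r; M \<in> carrier_mat r r; N \<in> carrier_mat r r\<rbrakk>
    \<Longrightarrow> gact r (K * (M * N)) f = gact r K (gact r M (gact r N f))"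
  by (simp add: gact_mult mult_carrier_mat[of _ r r _ r])

lemma lin_gact: "fun_space.lin (gact r M)"
  using lin_act[of "M - 1\<^sub>m r" r]
  by (auto simp: fun_space.lin_def gact_def fun_space.scale_right_distrib minus_carrier_mat)

lemma gact_one: "gact r (1\<^sub>m r) f = f"
  by (auto simp: fun_eq_iff gact_apply)

text \<open>The rank is the dimension of the column space, so a maximal independent set of columns has two
  elements; by maximality it spans the other columns.\<close>

lemma rank_two_image_plane:
  assumes M: "M \<in> carrier_mat r r" and rank: "vec_space.rank r M = 2"
  shows "fun_space.plane (range (act r M))"
proof -
  interpret V: vec_space "TYPE(complex)" r .
  define indep where "indep T \<longleftrightarrow> T \<subseteq> set (cols M) \<and> V.lin_indpt T" for T
  have cols: "set (cols M) \<subseteq> carrier_vec r" using M cols_dim by blast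
  have "indep {}" by (simp add: indep_def V.lin_dep_def)
  then obtain B where B: "finite B" "maximal B indep"
    using maximal_exists_superset[of "set (cols M)" indep "{}"] by (auto simp: indep_def)
  have "card B = 2"
    using V.rank_card_indpt[OF M, of B] B(2) rank unfolding indep_def[abs_def] by simp
  then obtain x y where xy: "B = {x, y}" "x \<noteq> y" by (auto simp: card_2_iff)
  have Bi: "B \<subseteq> set (cols M)" "V.lin_indpt B" using B(2) by (auto simp: maximal_def indep_def)
  then have Bc: "x \<in> carrier_vec r" "y \<in> carrier_vec r" using cols xy by auto
  have lc: "V.lincomb a B = a x \<cdot>\<^sub>v x + a y \<cdot>\<^sub>v y" for a
    using V.lincomb_insert2[of "{y}" a x] V.lincomb_insert2[of "{}" a y] xy Bc
    by simp
  have ind: "fun_space.indep2 (extend r x) (extend r y)"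
    unfolding fun_space.indep2_def
  proof (intro allI impI)
    fix p q assume "fscale p (extend r x) + fscale q (extend r y) = 0"
    then have "extend r (p \<cdot>\<^sub>v x + q \<cdot>\<^sub>v y) = 0" using Bc by (simp add: extend_plus extend_smult)
    then have "vec r (extend r (p \<cdot>\<^sub>v x + q \<cdot>\<^sub>v y)) = 0\<^sub>v r" by (simp add: vec_zero)
    then have "p \<cdot>\<^sub>v x + q \<cdot>\<^sub>v y = 0\<^sub>v r" using Bc by (simp add: vec_extend)
    then have "V.lincomb (\<lambda>v. if v = x then p else q) B = 0\<^sub>v r" using xy(2) by (simp add: lc)
    from V.not_lindepD[OF Bi(2) B(1) order.refl _ this]
    show "p = 0 \<and> q = 0" using xy by auto
  qed
  have act_unit: "act r M (extend r (unit_vec r j)) = extend r (col M j)" if "j < r" for j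
  proof -
    have "M *\<^sub>v unit_vec r j = col M j"
      using that M by (intro eq_vecI) (auto simp: scalar_prod_right_unit[of _ r])
    then show ?thesis by (simp add: act_def vec_extend)
  qed
  have col_in: "\<exists>j<r. v = col M j" if "v \<in> set (cols M)" for v
    using that M by (auto simp: cols_def)
  have B_range: "extend r x \<in> range (act r M)" "extend r y \<in> range (act r M)"
    using col_in[of x] col_in[of y] Bi(1) xy(1) act_unit by (metis insert_subset rangeI)+
  have col_span: "extend r (col M j) \<in> fun_space.span {extend r x, extend r y}" if j: "j < r" for j
  proof -
    have c: "col M j \<in> set (cols M)" using j M by (auto simp: cols_def)
    have "col M j \<in> V.span B"
    proof (cases "col M j \<in> B")
      case True
      then show ?thesis using V.span_mem[of B] Bc xy by auto
    next
      case False
      then have "\<not> indep (B \<union> {col M j})" using B(2) unfolding maximal_def by blast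
      then have "V.lin_dep (B \<union> {col M j})" using c Bi by (auto simp: indep_def)
      then show ?thesis using V.lin_dep_iff_in_span[of B "col M j"] False Bi(2) Bc xy c cols by auto
    qed
    then obtain a where "col M j = V.lincomb a B"
      using V.finite_span[OF B(1)] Bc xy by auto
    then have "extend r (col M j) = fscale (a x) (extend r x) + fscale (a y) (extend r y)"
      using Bc by (simp add: lc extend_plus extend_smult)
    then show ?thesis unfolding fun_space.span_pair by blast
  qed
  have "act r M f \<in> fun_space.span {extend r x, extend r y}" for f
  proof -
    have "act r M f = (\<Sum>j<r. fscale (f j) (extend r (col M j)))"
      using M by (auto simp: fun_eq_iff act_def extend_def sum_fun_apply scalar_prod_def
          lessThan_atLeast0 mult.commute intro!: sum.cong)
    then show ?thesis
      using col_span by (auto intro!: fun_space.span_sum fun_space.span_scale)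
  qed
  moreover have "fun_space.span {extend r x, extend r y} \<subseteq> range (act r M)"
    using B_range fun_space.subspace_lin_image[OF lin_act[OF M] fun_space.subspace_UNIV]
    by (intro fun_space.span_minimal) auto
  ultimately have "range (act r M) = fun_space.span {extend r x, extend r y}" by blast
  then show ?thesis using ind unfolding fun_space.plane_def by blast
qed

definition unit_fun :: "nat \<Rightarrow> nat \<Rightarrow> complex" where
  "unit_fun k = (\<lambda>i. if i = k then 1 else 0)"

lemma sum_unit_fun: "(\<Sum>k<r. fscale (x k) (unit_fun k)) i = (if i < r then x i else 0)"
  by (simp add: sum_fun_apply unit_fun_def if_distrib sum.delta' cong: if_cong)

lemma span_unit_fun: "fun_space.span (unit_fun ` {..<r}) = coords r"
proof
  show "fun_space.span (unit_fun ` {..<r}) \<subseteq> coords r"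
    by (intro fun_space.span_minimal subspace_coords) (auto simp: unit_fun_def coords_def)
  show "coords r \<subseteq> fun_space.span (unit_fun ` {..<r})"
  proof
    fix f assume "f \<in> coords r"
    then have "f = (\<Sum>k<r. fscale (f k) (unit_fun k))"
      by (auto simp: fun_eq_iff sum_unit_fun coords_def)
    also have "\<dots> \<in> fun_space.span (unit_fun ` {..<r})"
      by (intro fun_space.span_sum fun_space.span_scale fun_space.span_base) auto
    finally show "f \<in> fun_space.span (unit_fun ` {..<r})" .
  qed
qed

lemma dim_coords: "fun_space.dim (coords r) = r"
proof -
  have "\<forall>k<r. x k = 0" if "(\<Sum>k<r. fscale (x k) (unit_fun k)) = 0" for x
  proof (intro allI impI)
    fix k assume "k < r"
    then show "x k = 0" using fun_cong[OF that, of k] by (simp add: sum_unit_fun)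
  qed
  note fun_space.independent_family[OF this]
  then show ?thesis
    using fun_space.dim_span_eq_card_independent[of "unit_fun ` {..<r}"] by (simp add: span_unit_fun card_image)
qed

text \<open>Counting dimensions identifies the length of the chain of the braid group with that of the
  column vectors. The matrix with the basis as columns has trivial kernel, hence an inverse.\<close>

lemma basis_matrix:
  assumes span: "fun_space.span (y ` {..<n}) = coords r"
    and ind: "\<And>x. (\<Sum>k<n. fscale (x k) (y k)) = 0 \<Longrightarrow> \<forall>k<n. x k = 0"
  obtains Q where "n = r" "Q \<in> carrier_mat r r" "mat r r (\<lambda>(i, k). y k i) * Q = 1\<^sub>m r"
    "Q * mat r r (\<lambda>(i, k). y k i) = 1\<^sub>m r"
proof -
  note fam = fun_space.independent_family[where y = y and m = n, OF ind]
  have nr: "n = r"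
    using fun_space.dim_span_eq_card_independent[OF fam(2)] fam(1)
    by (simp add: span dim_coords card_image)
  let ?P = "mat r r (\<lambda>(i, k). y k i)"
  have P: "?P \<in> carrier_mat r r" by simp
  have yR: "y k \<in> coords r" if "k < r" for k
    using that nr span by (metis fun_space.span_base imageI lessThan_iff)
  have "det ?P \<noteq> 0"
  proof
    assume "det ?P = 0"
    then obtain v where v: "v \<in> carrier_vec r" "v \<noteq> 0\<^sub>v r" "?P *\<^sub>v v = 0\<^sub>v r"
      using det_0_iff_vec_prod_zero_field[OF P] by auto
    have "(\<Sum>k<n. fscale (v $ k) (y k)) i = 0" for i
    proof (cases "i < r")
      case True
      have "(\<Sum>k<r. v $ k * y k i) = (?P *\<^sub>v v) $ i"
        using True v(1) by (auto simp: scalar_prod_def lessThan_atLeast0 mult.commute intro!: sum.cong)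
      then show ?thesis using True v(3) nr by (simp add: sum_fun_apply)
    next
      case False
      then show ?thesis using yR nr by (simp add: sum_fun_apply coords_def)
    qed
    then have "\<forall>k<n. v $ k = 0" by (intro ind) (auto simp: fun_eq_iff)
    then have "v = 0\<^sub>v r" using v(1) nr by auto
    then show False using v(2) by simp
  qed
  then have "?P \<in> Units (ring_mat TYPE(complex) r ())" by (rule det_non_zero_imp_unit[OF P])
  then show ?thesis using that nr by (auto simp: Units_def ring_mat_def)
qed

section \<open>Representations of the braid group\<close>

lemma group_braid_group: "group (braid_group n)"
  unfolding braid_group_def by (rule group_presented_group)

lemma braid_group_induct [consumes 1, case_names one sigma inv_sigma]:
  assumes g: "g \<in> carrier (braid_group n)"
    and one: "P \<one>\<^bsub>braid_group n\<^esub>"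
    and pos: "\<And>i g. \<lbrakk>i \<in> {1..<n}; g \<in> carrier (braid_group n); P g\<rbrakk>
      \<Longrightarrow> P (sigma n i \<otimes>\<^bsub>braid_group n\<^esub> g)"
    and neg: "\<And>i g. \<lbrakk>i \<in> {1..<n}; g \<in> carrier (braid_group n); P g\<rbrakk>
      \<Longrightarrow> P (inv\<^bsub>braid_group n\<^esub> sigma n i \<otimes>\<^bsub>braid_group n\<^esub> g)"
  shows "P g"
proof -
  note One_nat_def [simp del]
  let ?S = "{1..<n}" and ?c = "pres_class {1..<n} (braid_rels n)"
  interpret group "braid_group n" by (rule group_braid_group)
  have mult: "?c v \<otimes>\<^bsub>braid_group n\<^esub> ?c w = ?c (v @ w)"
    if "v \<in> lists (?S \<times> UNIV)" "w \<in> lists (?S \<times> UNIV)" for v w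
    using pres_mult_class[OF that] by (simp add: braid_group_def)
  have closed: "?c w \<in> carrier (braid_group n)" if "w \<in> lists (?S \<times> UNIV)" for w
    using that unfolding braid_group_def pres_carrier by (rule imageI)
  have c_one: "?c [] = \<one>\<^bsub>braid_group n\<^esub>"
    unfolding braid_group_def by (rule pres_one[symmetric])
  have c_inv: "?c [(i, False)] = inv\<^bsub>braid_group n\<^esub> sigma n i" if i: "i \<in> ?S" for i
  proof -
    have "pres_eq ?S (braid_rels n) ([] @ [(i, False), (i, \<not> False)] @ []) ([] @ [])"
      using i by (intro pres_eq.cancel) auto
    then have "?c [(i, False), (i, True)] = ?c []"
      using i by (subst pres_class_eq_iff) auto
    then have "?c [(i, False)] \<otimes>\<^bsub>braid_group n\<^esub> sigma n i = \<one>\<^bsub>braid_group n\<^esub>"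
      using i mult[of "[(i, False)]" "[(i, True)]"] by (simp add: sigma_def c_one)
    then show ?thesis
      using i closed[of "[(i, False)]"] sigma_carrier[of i n] by (intro inv_equality[symmetric]) auto
  qed
  from g obtain w where w: "w \<in> lists (?S \<times> UNIV)" "g = ?c w"
    unfolding braid_group_def pres_carrier by blast
  from w(1) have "P (?c w)"
  proof (induction w)
    case Nil
    then show ?case using one by (simp add: c_one)
  next
    case (Cons a w)
    obtain i b where a: "a = (i, b)" by (cases a)
    have i: "i \<in> ?S" using Cons a by auto
    have wl: "w \<in> lists (?S \<times> UNIV)" using Cons by auto
    have eq: "?c (a # w) = ?c [a] \<otimes>\<^bsub>braid_group n\<^esub> ?c w"
      using mult[of "[a]" w] a i wl by simp
    show ?case
    proof (cases b)
      case True
      then show ?thesis using pos[OF i closed[OF wl]] Cons eq a by (simp add: sigma_def)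
    next
      case False
      then show ?thesis using neg[OF i closed[OF wl]] Cons eq a c_inv[OF i] by simp
    qed
  qed
  then show ?thesis using w by simp
qed

lemma sigma_commute:
  assumes "i \<in> {1..<n}" "j \<in> {1..<n}" "\<bar>int i - int j\<bar> \<ge> 2"
  shows "sigma n i \<otimes>\<^bsub>braid_group n\<^esub> sigma n j = sigma n j \<otimes>\<^bsub>braid_group n\<^esub> sigma n i"
proof -
  let ?v = "[(i, True), (j, True)]" and ?w = "[(j, True), (i, True)]"
  have l: "?v \<in> lists ({1..<n} \<times> UNIV)" "?w \<in> lists ({1..<n} \<times> UNIV)" using assms by auto
  have "(?v, ?w) \<in> braid_rels n" unfolding braid_rels_def using assms by blast
  then have "pres_eq {1..<n} (braid_rels n) ([] @ ?v @ []) ([] @ ?w @ [])"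
    by (rule pres_eq.rel) (use l in auto)
  then have "pres_class {1..<n} (braid_rels n) ?v = pres_class {1..<n} (braid_rels n) ?w"
    unfolding append_Nil append_Nil2 pres_class_eq_iff[OF l(1)] .
  then show ?thesis using l by (simp add: sigma_def braid_group_def pres_mult_class)
qed

lemma rep_facts:
  assumes \<rho>: "\<rho> \<in> hom (braid_group n) (GL r)"
  shows "\<And>g. g \<in> carrier (braid_group n) \<Longrightarrow> \<rho> g \<in> carrier_mat r r"
    and "\<And>g h. \<lbrakk>g \<in> carrier (braid_group n); h \<in> carrier (braid_group n)\<rbrakk>
      \<Longrightarrow> \<rho> (g \<otimes>\<^bsub>braid_group n\<^esub> h) = \<rho> g * \<rho> h"
    and "\<rho> \<one>\<^bsub>braid_group n\<^esub> = 1\<^sub>m r"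
    and "\<And>g. g \<in> carrier (braid_group n) \<Longrightarrow> \<rho> g * \<rho> (inv\<^bsub>braid_group n\<^esub> g) = 1\<^sub>m r"
    and "\<And>g. g \<in> carrier (braid_group n) \<Longrightarrow> \<rho> (inv\<^bsub>braid_group n\<^esub> g) * \<rho> g = 1\<^sub>m r"
proof -
  interpret B: group "braid_group n" by (rule group_braid_group)
  interpret hom: group_hom "braid_group n" "GL r" \<rho>
    by (intro group_hom.intro group_hom_axioms.intro group_braid_group group_GL \<rho>)
  show carrier: "\<rho> g \<in> carrier_mat r r" if "g \<in> carrier (braid_group n)" for g
    using hom.hom_closed[OF that] unfolding GL_simps by blast
  show mult: "\<rho> (g \<otimes>\<^bsub>braid_group n\<^esub> h) = \<rho> g * \<rho> h"
    if "g \<in> carrier (braid_group n)" "h \<in> carrier (braid_group n)" for g h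
    using hom.hom_mult[OF that] by (simp add: GL_simps)
  show one: "\<rho> \<one>\<^bsub>braid_group n\<^esub> = 1\<^sub>m r"
    using hom.hom_one by (simp add: GL_simps)
  show "\<rho> g * \<rho> (inv\<^bsub>braid_group n\<^esub> g) = 1\<^sub>m r" if "g \<in> carrier (braid_group n)" for g
    using mult[of g "inv\<^bsub>braid_group n\<^esub> g"] that one by (metis B.r_inv B.inv_closed)
  show "\<rho> (inv\<^bsub>braid_group n\<^esub> g) * \<rho> g = 1\<^sub>m r" if "g \<in> carrier (braid_group n)" for g
    using mult[of "inv\<^bsub>braid_group n\<^esub> g" g] that one by (metis B.l_inv B.inv_closed)
qed

text \<open>The identity outside the range of generators is a default value that makes the corresponding
  displacement vanish.\<close>

definition gen :: "nat \<Rightarrow> nat \<Rightarrow> (nat gword set \<Rightarrow> complex mat) \<Rightarrow> nat \<Rightarrow> complex mat" where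
  "gen n r \<rho> i = (if i \<in> {1..<n} then \<rho> (sigma n i) else 1\<^sub>m r)"

text \<open>Irreducibility speaks of subspaces invariant under the whole group, \<open>simple\<close> only of invariance
  under the displacements of the generators; finite dimension bridges the gap, as it makes
  such a subspace invariant under the inverses of the generators.\<close>

lemma corank_two_braiding_rep:
  assumes n: "n \<ge> 7" and \<rho>: "\<rho> \<in> hom (braid_group n) (GL r)"
    and irr: "irreducible_rep (braid_group n) r \<rho>" and corank: "corank n r \<rho> = 2"
  shows "corank_two_braiding fscale n (\<lambda>i. act r (gen n r \<rho> i - 1\<^sub>m r)) (coords r)"
proof -
  let ?M = "gen n r \<rho>" and ?A = "\<lambda>i. act r (gen n r \<rho> i - 1\<^sub>m r)"
  interpret B: group "braid_group n" by (rule group_braid_group)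
  note rep = rep_facts[OF \<rho>]
  have M: "?M i \<in> carrier_mat r r" for i
    using rep(1) sigma_carrier by (simp add: gen_def)
  have M1: "?M i - 1\<^sub>m r \<in> carrier_mat r r" for i by (rule minus_carrier_mat) simp
  have g: "v + ?A i v = gact r (?M i) v" for i v by (simp add: gact_def)
  have inverse: "gact r (?M i) (gact r (\<rho> (inv\<^bsub>braid_group n\<^esub> sigma n i)) v) = v"
    "gact r (\<rho> (inv\<^bsub>braid_group n\<^esub> sigma n i)) (gact r (?M i) v) = v"
    if "1 \<le> i" "i < n" for i v
  proof -
    have s: "sigma n i \<in> carrier (braid_group n)" using that by (intro sigma_carrier) auto
    have N: "\<rho> (inv\<^bsub>braid_group n\<^esub> sigma n i) \<in> carrier_mat r r"
      by (rule rep(1)[OF B.inv_closed[OF s]])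
    have Mi: "?M i = \<rho> (sigma n i)" using that by (simp add: gen_def)
    show "gact r (?M i) (gact r (\<rho> (inv\<^bsub>braid_group n\<^esub> sigma n i)) v) = v"
      using gact_mult[OF M[of i] N, of v] by (simp add: Mi rep(4)[OF s] gact_one)
    show "gact r (\<rho> (inv\<^bsub>braid_group n\<^esub> sigma n i)) (gact r (?M i) v) = v"
      using gact_mult[OF N M[of i], of v] by (simp add: Mi rep(5)[OF s] gact_one)
  qed
  have zero: "gact r N 0 = 0" if "N \<in> carrier_mat r r" for N
    using that by (auto simp: fun_eq_iff gact_apply vec_zero)
  have M_inj: "v = 0" if "1 \<le> i" "i < n" "gact r (?M i) v = 0" for i v
  proof -
    have "\<rho> (inv\<^bsub>braid_group n\<^esub> sigma n i) \<in> carrier_mat r r"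
      using that sigma_carrier[of i n] by (intro rep(1)) auto
    then show ?thesis using inverse(2)[OF that(1,2), of v] that(3) zero by simp
  qed
  have range: "act r N f \<in> coords r" for N f unfolding act_def by (rule extend_coords)
  show ?thesis
  proof (unfold_locales, unfold g Let_def)
    show "7 \<le> n" by (rule n)
    show "fun_space.lin (?A i)" for i by (rule lin_act[OF M1])
    show "\<And>i v. \<lbrakk>1 \<le> i; i < n; gact r (?M i) v = 0\<rbrakk> \<Longrightarrow> v = 0" by (rule M_inj)
    show "\<exists>u. gact r (?M i) u = v" if "1 \<le> i" "i < n" for i v using inverse(1)[OF that] by blast
    show "?A i (?A j v) = ?A j (?A i v)" if ij: "1 \<le> i" "i + 2 \<le> j" "j < n" for i j v
    proof -
      have s: "sigma n i \<in> carrier (braid_group n)" "sigma n j \<in> carrier (braid_group n)"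
        using ij by (auto intro: sigma_carrier)
      have "?M i * ?M j = ?M j * ?M i"
        using arg_cong[OF sigma_commute[of i n j], of \<rho>] ij s by (simp add: gen_def rep(2))
      then have "gact r (?M i) (gact r (?M j) v) = gact r (?M j) (gact r (?M i) v)"
        using gact_mult[OF M M] by metis
      moreover have "?A k w = gact r (?M k) w - w" for k w by (simp add: gact_def)
      ultimately show ?thesis by (simp add: fun_space.lin_diff[OF lin_gact])
    qed
    show "gact r (?M i) (gact r (?M (Suc i)) (gact r (?M i) v)) =
        gact r (?M (Suc i)) (gact r (?M i) (gact r (?M (Suc i)) v))"
      if i: "1 \<le> i" "Suc i < n" for i v
    proof -
      have s: "sigma n i \<in> carrier (braid_group n)" "sigma n (Suc i) \<in> carrier (braid_group n)"
        using i by (auto intro: sigma_carrier)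
      have "?M i * (?M (Suc i) * ?M i) = ?M (Suc i) * (?M i * ?M (Suc i))"
        using arg_cong[OF sigma_braid[of i n], of \<rho>] i s by (simp add: gen_def rep(2))
      then show ?thesis using gact_mult3[OF M M M] by metis
    qed
    show "fun_space.subspace (coords r)" by (rule subspace_coords)
    show "?A i ` coords r = range (?A i)" for i
    proof -
      have "?A i f = ?A i (extend r (vec r f))" for f
        by (simp add: act_def vec_extend)
      then show ?thesis using extend_coords by blast
    qed
    show "range (?A i) \<subseteq> coords r" for i using range by blast
    show "fun_space.plane (range (?A i))" if i: "1 \<le> i" "i < n" for i
      using rank_two_image_plane[OF M1[of i]] corank_eq[OF \<rho>, of i] corank i by (simp add: gen_def)
    show "U = coords r"
      if U: "fun_space.subspace U" "U \<subseteq> coords r" "U \<noteq> {0}"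
        and inv: "\<And>i u. \<lbrakk>1 \<le> i; i < n; u \<in> U\<rbrakk> \<Longrightarrow> ?A i u \<in> U" for U
    proof -
      have gU: "gact r (?M i) u \<in> U" if "1 \<le> i" "i < n" "u \<in> U" for i u
        using fun_space.subspace_add[OF U(1) that(3) inv[OF that]] by (simp add: gact_def)
      have onto: "gact r (?M i) ` U = U" if i: "1 \<le> i" "i < n" for i
      proof (rule fun_space.invariant_subspace_onto)
        show "fun_space.lin (gact r (?M i))" by (rule lin_gact)
        show "U \<subseteq> fun_space.span (unit_fun ` {..<r})" using U(2) by (simp add: span_unit_fun)
      qed (use i U gU M_inj in auto)
      have group_inv: "\<forall>u\<in>U. gact r (\<rho> g) u \<in> U" if "g \<in> carrier (braid_group n)" for g
        using that
      proof (induction rule: braid_group_induct)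
        case one
        then show ?case by (simp add: rep(3) gact_one)
      next
        case (sigma i g)
        then show ?case
          using gU[of i] M[of i] sigma_carrier[of i n] rep(1,2) by (simp add: gen_def gact_mult)
      next
        case (inv_sigma i g)
        have N: "inv\<^bsub>braid_group n\<^esub> sigma n i \<in> carrier (braid_group n)"
          using inv_sigma sigma_carrier[of i n] by simp
        have "gact r (\<rho> (inv\<^bsub>braid_group n\<^esub> sigma n i)) u \<in> U" if "u \<in> U" for u
        proof -
          obtain u' where "u' \<in> U" "u = gact r (?M i) u'"
            using onto[of i] inv_sigma(1) \<open>u \<in> U\<close> by auto
          then show ?thesis using inverse(2)[of i u'] inv_sigma(1) by simp
        qed
        then show ?case using inv_sigma N rep(1,2) by (simp add: gact_mult)
      qed
      let ?W = "vec r ` U"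
      have "submodule class_ring ?W (module_vec TYPE(complex) r)"
      proof (rule submodule.intro[OF vec_module])
        show "?W \<subseteq> carrier (module_vec TYPE(complex) r)" by (auto simp: module_vec_simps)
        show "\<zero>\<^bsub>module_vec TYPE(complex) r\<^esub> \<in> ?W"
          unfolding module_vec_simps vec_zero[symmetric]
          by (rule imageI) (rule fun_space.subspace_0[OF U(1)])
        fix v w assume "v \<in> ?W" "w \<in> ?W"
        then obtain f g where "f \<in> U" "g \<in> U" "v = vec r f" "w = vec r g" by blast
        then show "v \<oplus>\<^bsub>module_vec TYPE(complex) r\<^esub> w \<in> ?W"
          unfolding module_vec_simps
          using fun_space.subspace_add[OF U(1)] by (intro image_eqI[of _ _ "f + g"]) (simp_all only: vec_plus)
      next
        fix c v assume "v \<in> ?W"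
        then obtain f where "f \<in> U" "v = vec r f" by blast
        then show "c \<odot>\<^bsub>module_vec TYPE(complex) r\<^esub> v \<in> ?W"
          unfolding module_vec_simps
          using fun_space.subspace_scale[OF U(1)]
          by (intro image_eqI[of _ _ "fscale c f"]) (simp_all only: vec_fscale)
      qed
      then have sub: "subspace class_ring ?W (module_vec TYPE(complex) r)"
        by (simp add: subspace_def vec_vs)
      have "\<rho> g *\<^sub>v w \<in> ?W" if g: "g \<in> carrier (braid_group n)" and w: "w \<in> ?W" for g w
      proof -
        obtain u where u: "u \<in> U" "w = vec r u" using w by blast
        then have "\<rho> g *\<^sub>v w = vec r (gact r (\<rho> g) u)"
          using vec_gact[OF rep(1)[OF g]] by simp
        then show ?thesis using group_inv[OF g] u(1) by blast
      qed
      then have "?W = {0\<^sub>v r} \<or> ?W = carrier_vec r"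
        using irr sub unfolding irreducible_rep_def by blast
      then show "U = coords r"
      proof
        assume W: "?W = {0\<^sub>v r}"
        have "u = 0" if "u \<in> U" for u
        proof -
          have "vec r u = 0\<^sub>v r" using W that by blast
          then show ?thesis using extend_vec[of u r] U(2) that by (auto simp: extend_zero)
        qed
        then show ?thesis using U(3) fun_space.subspace_0[OF U(1)] by blast
      next
        assume W: "?W = carrier_vec r"
        have "f \<in> U" if f: "f \<in> coords r" for f
        proof -
          have "vec r f \<in> ?W" unfolding W by simp
          then obtain u where "u \<in> U" "vec r f = vec r u" by blast
          then show ?thesis using extend_vec[OF f] extend_vec[of u r] U(2) by auto
        qed
        then show ?thesis using U(2) by blast
      qed
    qed
  qed
qed

lemma equivalent_repsI:
  assumes \<rho>: "\<rho> \<in> hom (braid_group n) (GL r)" and \<tau>: "\<tau> \<in> hom (braid_group n) (GL r)"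
    and P: "P \<in> carrier_mat r r" and Q: "Q \<in> carrier_mat r r" "P * Q = 1\<^sub>m r" "Q * P = 1\<^sub>m r"
    and gens: "\<And>i. i \<in> {1..<n} \<Longrightarrow> \<rho> (sigma n i) * P = P * \<tau> (sigma n i)"
  shows "equivalent_reps (braid_group n) \<rho> \<tau>"
proof -
  interpret B: group "braid_group n" by (rule group_braid_group)
  note \<rho>f = rep_facts[OF \<rho>] and \<tau>f = rep_facts[OF \<tau>]
  have step: "\<rho> (h \<otimes>\<^bsub>braid_group n\<^esub> g) * P = P * \<tau> (h \<otimes>\<^bsub>braid_group n\<^esub> g)"
    if h: "h \<in> carrier (braid_group n)" "\<rho> h * P = P * \<tau> h"
      and g: "g \<in> carrier (braid_group n)" "\<rho> g * P = P * \<tau> g" for h g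
  proof -
    have "\<rho> h * \<rho> g * P = \<rho> h * (P * \<tau> g)"
      using \<rho>f(1)[OF h(1)] \<rho>f(1)[OF g(1)] P g(2) by simp
    also have "\<dots> = \<rho> h * P * \<tau> g"
      using \<rho>f(1)[OF h(1)] \<tau>f(1)[OF g(1)] P by simp
    also have "\<dots> = P * (\<tau> h * \<tau> g)"
      using \<tau>f(1)[OF h(1)] \<tau>f(1)[OF g(1)] P by (simp add: h(2))
    finally show ?thesis using h g by (simp add: \<rho>f(2) \<tau>f(2))
  qed
  have intertwine: "\<rho> g * P = P * \<tau> g" if "g \<in> carrier (braid_group n)" for g
    using that
  proof (induction rule: braid_group_induct)
    case one
    then show ?case using P by (simp add: \<rho>f(3) \<tau>f(3))
  next
    case (sigma i g)
    then show ?case by (intro step gens sigma_carrier) auto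
  next
    case (inv_sigma i g)
    let ?s = "sigma n i" and ?t = "inv\<^bsub>braid_group n\<^esub> sigma n i"
    have s: "?s \<in> carrier (braid_group n)" "?t \<in> carrier (braid_group n)"
      using inv_sigma sigma_carrier[of i n] by auto
    have c: "\<rho> ?s \<in> carrier_mat r r" "\<rho> ?t \<in> carrier_mat r r"
      "\<tau> ?s \<in> carrier_mat r r" "\<tau> ?t \<in> carrier_mat r r"
      using s \<rho>f(1) \<tau>f(1) by auto
    have Pt: "P * \<tau> ?t \<in> carrier_mat r r" using P c(4) by simp
    have "P = P * \<tau> ?s * \<tau> ?t"
      using P s(1) by (simp only: assoc_mult_mat[OF P c(3,4)] \<tau>f(4) right_mult_one_mat)
    also have "\<dots> = \<rho> ?s * (P * \<tau> ?t)"
      by (simp only: gens[OF inv_sigma(1), symmetric] assoc_mult_mat[OF c(1) P c(4)])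
    finally have "\<rho> ?t * P = \<rho> ?t * (\<rho> ?s * (P * \<tau> ?t))" by (rule arg_cong)
    also have "\<dots> = (\<rho> ?t * \<rho> ?s) * (P * \<tau> ?t)"
      by (rule assoc_mult_mat[OF c(2,1) Pt, symmetric])
    also have "\<dots> = P * \<tau> ?t"
      by (simp only: \<rho>f(5)[OF s(1)] left_mult_one_mat[OF Pt])
    finally show ?case using inv_sigma s by (intro step) auto
  qed
  have "similar_mat_wit (\<rho> g) (\<tau> g) P Q" if g: "g \<in> carrier (braid_group n)" for g
  proof (rule similar_mat_witI)
    have "P * \<tau> g * Q = \<rho> g * P * Q" using intertwine[OF g] by simp
    also have "\<dots> = \<rho> g" using \<rho>f(1)[OF g] P Q by simp
    finally show "\<rho> g = P * \<tau> g * Q" by simp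
  qed (use P Q \<rho>f(1)[OF g] \<tau>f(1)[OF g] in auto)
  then show ?thesis unfolding equivalent_reps_def by blast
qed

theorem corollary5p6:
  fixes n r :: nat and \<rho> :: "nat gword set \<Rightarrow> complex mat"
  assumes "n \<ge> 7"
    and "\<rho> \<in> hom (braid_group n) (GL r)"
    and "irreducible_rep (braid_group n) r \<rho>"
    and "corank n r \<rho> = 2"
  shows "\<exists>u::complex. u \<noteq> 0 \<and> u \<noteq> 1 \<and>
    equivalent_reps (braid_group n) \<rho> (standard_rep n u)"
proof -
  interpret L: corank_two_braiding fscale n "\<lambda>i. act r (gen n r \<rho> i - 1\<^sub>m r)" "coords r"
    using assms by (rule corank_two_braiding_rep)
  obtain y t where t: "t \<noteq> 0" "t \<noteq> 1" and span: "fun_space.span (y ` {..<n}) = coords r"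
    and ind: "\<And>x. (\<Sum>k<n. fscale (x k) (y k)) = 0 \<Longrightarrow> \<forall>k<n. x k = 0"
    and S1: "\<And>m. Suc m < n \<Longrightarrow> L.S (Suc m) (y m) = y (Suc m)"
    and S2: "\<And>m. Suc m < n \<Longrightarrow> L.S (Suc m) (y (Suc m)) = fscale t (y m)"
    and S3: "\<And>m k. \<lbrakk>Suc m < n; k < n; k \<noteq> m; k \<noteq> Suc m\<rbrakk> \<Longrightarrow> L.S (Suc m) (y k) = y k"
    by (rule L.standard_basis) (rule that; assumption)
  obtain Q where nr: "n = r" and Q: "Q \<in> carrier_mat r r" "mat r r (\<lambda>(i, k). y k i) * Q = 1\<^sub>m r"
    "Q * mat r r (\<lambda>(i, k). y k i) = 1\<^sub>m r"
    using basis_matrix[OF span ind] by blast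
  let ?P = "mat r r (\<lambda>(i, k). y k i)"
  have "equivalent_reps (braid_group n) \<rho> (standard_rep n t)"
  proof (rule equivalent_repsI[OF assms(2) _ _ Q])
    show "standard_rep n t \<in> hom (braid_group n) (GL r)" using standard_rep_hom[OF t(1), of n] nr by simp
    fix i assume i: "i \<in> {1..<n}"
    then obtain m where m: "i = Suc m" "Suc m < n" by (cases i) auto
    let ?M = "\<rho> (sigma n i)"
    have M: "?M \<in> carrier_mat r r" using rep_facts(1)[OF assms(2)] sigma_carrier[OF i] by blast
    have "gen n r \<rho> i = ?M" using i by (simp add: gen_def)
    then have S: "L.S i v = gact r ?M v" for v by (simp only: L.S_def gact_def)
    have "?M * ?P = ?P * standard_mat r t i"
    proof (rule eq_matI)
      fix a k assume "a < dim_row (?P * standard_mat r t i)" "k < dim_col (?P * standard_mat r t i)"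
      then have ak: "a < r" "k < r" by (auto simp: standard_mat_def)
      have "(?M * ?P) $$ (a, k) = (?M *\<^sub>v vec r (y k)) $ a"
        using ak M by (auto simp: scalar_prod_def intro!: sum.cong)
      also have "\<dots> = L.S i (y k) a" using ak M by (simp add: S gact_apply)
      also have "\<dots> = (\<Sum>j<r. y j a * standard_mat r t i $$ (j, k))"
      proof -
        consider "k = m" | "k = Suc m" | "k \<noteq> m" "k \<noteq> Suc m" by blast
        then show ?thesis
        proof cases
          case 1
          have "(\<Sum>j<r. y j a * standard_mat r t i $$ (j, k)) = (\<Sum>j<r. if j = Suc m then y j a else 0)"
            using 1 ak m by (intro sum.cong) (auto simp: standard_mat_def)
          then show ?thesis using 1 m nr S1[of m] by simp
        next
          case 2
          have "(\<Sum>j<r. y j a * standard_mat r t i $$ (j, k)) = (\<Sum>j<r. if j = m then t * y j a else 0)"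
            using 2 ak m by (intro sum.cong) (auto simp: standard_mat_def)
          then show ?thesis using 2 m nr S2[of m] by simp
        next
          case 3
          have "(\<Sum>j<r. y j a * standard_mat r t i $$ (j, k)) = (\<Sum>j<r. if j = k then y j a else 0)"
            using 3 ak m by (intro sum.cong) (auto simp: standard_mat_def)
          then show ?thesis using 3 m nr ak S3[of m k] by simp
        qed
      qed
      also have "\<dots> = (?P * standard_mat r t i) $$ (a, k)"
        using ak by (auto simp: scalar_prod_def lessThan_atLeast0 standard_mat_def intro!: sum.cong)
      finally show "(?M * ?P) $$ (a, k) = (?P * standard_mat r t i) $$ (a, k)" .
    qed (use M in \<open>auto simp: standard_mat_def\<close>)
    then show "?M * ?P = ?P * standard_rep n t (sigma n i)"
      using standard_rep_sigma[OF t(1) i] nr by simp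
  qed simp
  then show ?thesis using t by blast
qed

end
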